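(* There is an absolute constant $C$ such that for all integers $a\ge 3$, $$\Big|\gamma_{1,1,a}-\frac15\Big|\le C\,\frac{\log\log a}{\log a}.$$
   Context: For integers $a,b,c$ and a finite set $S\subset\mathbb{Z}$, let $T_{a,b,c}(S)=\#\{(x,y,z)\in S^3: ax+by+cz=0\}$, and let $\gamma_{a,b,c}=\limsup_{|S|\to+\infty}T_{a,b,c}(S)/|S|^2$, the limsup being over finite sets $S\subset\mathbb{Z}$. *)

theory Defs
  imports Complex_Main "HOL-Library.Extended_Real" "HOL-Library.Liminf_Limsup"
begin

definition T_count :: "int \<Rightarrow> int \<Rightarrow> int \<Rightarrow> int set \<Rightarrow> nat" where
  "T_count a b c S =
     card {(x, y, z). x \<in> S \<and> y \<in> S \<and> z \<in> S \<and> a * x + b * y + c * z = 0}"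

definition card_at_top :: "int set filter" where
  "card_at_top = inf (filtercomap card at_top) (principal {S. finite S})"

(* The limsup is taken in the extended reals, a complete lattice, so that it needs no
   boundedness side condition; it takes the value \<infinity> for a = b = c = 0. *)
definition gamma_coeff :: "int \<Rightarrow> int \<Rightarrow> int \<Rightarrow> ereal" where
  "gamma_coeff a b c =
     Limsup card_at_top (\<lambda>S. ereal (real (T_count a b c S) / (real (card S))\<^sup>2))"

lemma eventually_card_at_top:
  "eventually P card_at_top \<longleftrightarrow> (\<exists>N. \<forall>S. finite S \<and> N \<le> card S \<longrightarrow> P S)"
  unfolding card_at_top_def eventually_inf_principal eventually_filtercomap
    eventually_at_top_linorder
  by auto

end

(* The value 1/5 is attained by the sets a[-3k,3k] u [-2k,2k]: most of their solutions take
   x, y in the first piece and z in the second. Conversely, suppose that a level function on S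
   satisfies lev x = lev y = lev z + 1 for all but O(|S|^2/q) solutions. Consecutive levels of sizes
   p and m contribute at most p m - m^2/4 solutions up to rounding, and the total is at most |S|^2/5.

   To find the levels, split S by the Balog-Szemeredi-Gowers argument into at most 4q pieces of
   doubling q^O(1), up to a part that meets few solutions. A pair of pieces (U, V) carrying many
   solutions has |U + V| or |U + aV| at most q^O(1) |S|. If these relations were inconsistent as
   differences of levels, a closed walk of length O(q) and Ruzsa's triangle inequality would give
   a piece V and an s > 0 with |V + (+-a^s)V| at most q^O(q) |V|. Yet |V + cV| is at least |c| |V|
   for all large V, so q of order log a / log log a is admissible. *)
theory Submission
  imports Defs
begin

section \<open>Sums of dilates\<close>

text \<open>Two limits are kept apart. The integers \<open>a\<close> and \<open>q\<close> are fixed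
  before \<open>card S\<close> grows, so a threshold in the dilate bound costs nothing: only the
  finitely many dilates +-a^s with 1 \<le> s \<le> 8 q can arise, and every piece has at least
  \<open>card S\<close> / (4 q) elements. Both signs are needed because x + y + a z = 0 relates a
  piece to the negative of another, so every edge of a walk flips the sign of the composite dilate.

  The rate is set by the price of a closed walk. One relation costs 2^25 q^13, the square of the
  doubling 2^10 q^5 divided by the density 1 / (32 q^3); passing through a middle piece of size at
  least n / (4 q) makes this 2^27 q^14 per edge. Two shortest paths and one edge give fewer than 8 q
  edges, so the contradiction needs (2^27 q^14)^(8 q) \<le> a, while the discarded solutions have
  proportion O(1/q).\<close>

definition dilate_sum :: "int set \<Rightarrow> int \<Rightarrow> int set \<Rightarrow> int set" where
  "dilate_sum A c B = (\<lambda>(x, y). x + c * y) ` (A \<times> B)"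

lemma finite_dilate_sum [simp]:
  "finite A \<Longrightarrow> finite B \<Longrightarrow> finite (dilate_sum A c B)"
  by (simp add: dilate_sum_def)

lemma dilate_sum_memI: "x \<in> A \<Longrightarrow> y \<in> B \<Longrightarrow> x + c * y \<in> dilate_sum A c B"
  by (force simp: dilate_sum_def)

lemma dilate_sum_mono: "A \<subseteq> A' \<Longrightarrow> B \<subseteq> B' \<Longrightarrow> dilate_sum A c B \<subseteq> dilate_sum A' c B'"
  by (auto simp: dilate_sum_def)

lemma card_dilate_sum_ge:
  assumes "finite A" "finite B" "A \<noteq> {}" "c \<noteq> 0"
  shows "card B \<le> card (dilate_sum A c B)"
proof -
  obtain x where "x \<in> A" using assms by auto
  then have "(\<lambda>y. x + c * y) ` B \<subseteq> dilate_sum A c B"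
    by (auto intro: dilate_sum_memI)
  moreover have "card ((\<lambda>y. x + c * y) ` B) = card B"
    by (rule card_image) (auto simp: inj_on_def assms)
  ultimately show ?thesis
    by (metis assms(1,2) card_mono finite_dilate_sum)
qed

lemma card_dilate_sum_affine:
  assumes "g \<noteq> 0"
  shows "card (dilate_sum ((\<lambda>x. u + g * x) ` A) c ((\<lambda>x. v + g * x) ` B)) = card (dilate_sum A c B)"
proof -
  have "dilate_sum ((\<lambda>x. u + g * x) ` A) c ((\<lambda>x. v + g * x) ` B)
      = (\<lambda>s. u + c * v + g * s) ` dilate_sum A c B"
  proof (intro set_eqI iffI)
    fix s assume "s \<in> dilate_sum ((\<lambda>x. u + g * x) ` A) c ((\<lambda>x. v + g * x) ` B)"
    then obtain x y where "x \<in> A" "y \<in> B" "s = u + g * x + c * (v + g * y)"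
      by (auto simp: dilate_sum_def)
    then show "s \<in> (\<lambda>s. u + c * v + g * s) ` dilate_sum A c B"
      by (intro image_eqI[of _ _ "x + c * y"] dilate_sum_memI) (simp_all add: algebra_simps)
  next
    fix s assume "s \<in> (\<lambda>s. u + c * v + g * s) ` dilate_sum A c B"
    then obtain x y where "x \<in> A" "y \<in> B" "s = u + c * v + g * (x + c * y)"
      by (auto simp: dilate_sum_def)
    moreover from this have "s = (u + g * x) + c * (v + g * y)"
      by (simp add: algebra_simps)
    ultimately show "s \<in> dilate_sum ((\<lambda>x. u + g * x) ` A) c ((\<lambda>x. v + g * x) ` B)"
      by (metis dilate_sum_memI imageI)
  qed
  then show ?thesis
    by (simp add: card_image inj_on_def assms)
qed

text \<open>A sum x + c y is congruent to x modulo \<open>c\<close>, so distinct residue classes of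
  the left summand have disjoint sets of sums and can be estimated one by one.\<close>

lemma card_dilate_sum_classes:
  fixes A B :: "int set"
  assumes fin: "finite A" "finite B" and R: "finite R"
  shows "(\<Sum>r\<in>R. card (dilate_sum {x \<in> A. x mod c = r} c B)) \<le> card (dilate_sum A c B)"
proof -
  have "(\<Sum>r\<in>R. card (dilate_sum {x \<in> A. x mod c = r} c B))
      = card (\<Union>r\<in>R. dilate_sum {x \<in> A. x mod c = r} c B)"
  proof (rule card_UN_disjoint[symmetric])
    show "\<forall>i\<in>R. finite (dilate_sum {x \<in> A. x mod c = i} c B)"
      using fin by auto
    have "s mod c = i" if "s \<in> dilate_sum {x \<in> A. x mod c = i} c B" for s i
      using that by (auto simp: dilate_sum_def)
    then show "\<forall>i\<in>R. \<forall>j\<in>R. i \<noteq> j \<longrightarrow>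
        dilate_sum {x \<in> A. x mod c = i} c B \<inter> dilate_sum {x \<in> A. x mod c = j} c B = {}"
      by blast
  qed fact
  also have "\<dots> \<le> card (dilate_sum A c B)"
    by (intro card_mono) (auto simp: fin dilate_sum_def)
  finally show ?thesis .
qed

text \<open>The translations mapping P into itself form a subgroup because P is periodic.\<close>
lemma periods_generate:
  fixes P D :: "int set" and l :: int
  assumes l: "l > 0" and per: "\<And>u k. u \<in> P \<Longrightarrow> u + l * k \<in> P"
    and D: "\<And>u d. u \<in> P \<Longrightarrow> d \<in> D \<Longrightarrow> u + d \<in> P"
    and gen: "\<And>h. h > 0 \<Longrightarrow> \<forall>d\<in>D. h dvd d \<Longrightarrow> h = 1"
    and ne: "P \<noteq> {}"
  shows "P = UNIV"
proof -
  define H where "H = {d. \<forall>u\<in>P. u + d \<in> P}"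
  have H_l: "l * k \<in> H" for k using per by (auto simp: H_def)
  have H_add: "d + e \<in> H" if "d \<in> H" "e \<in> H" for d e
    using that by (auto simp: H_def add.assoc[symmetric])
  have H_mult: "int n * d \<in> H" if "d \<in> H" for d n
  proof (induction n)
    case 0 show ?case by (auto simp: H_def)
  next
    case (Suc n) then show ?case using H_add[OF that Suc] by (simp add: algebra_simps)
  qed
  have H_minus: "- d \<in> H" if "d \<in> H" for d
  proof -
    \<comment> \<open>Since -d = (l - 1) d - l d, periodicity modulo \<open>l\<close> supplies the
      inverses that closure under addition alone would not.\<close>
    have "int (nat (l - 1)) * d + l * (- d) \<in> H"
      by (intro H_add H_mult that H_l)
    then show ?thesis using l by (simp add: algebra_simps)
  qed
  have H_int: "k * d \<in> H" if "d \<in> H" for d k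
    using H_mult[OF that, of "nat k"] H_mult[OF H_minus[OF that], of "nat (- k)"]
    by (cases "k \<ge> 0") auto
  define m where "m = (LEAST m. m > 0 \<and> int m \<in> H)"
  have "nat l > 0 \<and> int (nat l) \<in> H" using l H_l[of 1] by auto
  then have m: "m > 0" "int m \<in> H"
    unfolding m_def by (rule LeastI2; blast)+
  have least: "m \<le> k" if "k > 0" "int k \<in> H" for k
    unfolding m_def by (rule Least_le) (use that in auto)
  have "int m dvd d" if d: "d \<in> H" for d
  proof -
    have "d + (- (d div int m)) * int m \<in> H"
      by (intro H_add d H_int m)
    moreover have "d + (- (d div int m)) * int m = d mod int m"
      by (simp add: minus_div_mult_eq_mod[symmetric])
    ultimately have "d mod int m \<in> H" by simp
    moreover have "0 \<le> d mod int m" "d mod int m < int m" using m by auto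
    ultimately have "d mod int m = 0"
      using least[of "nat (d mod int m)"] by (cases "d mod int m = 0") auto
    then show ?thesis by auto
  qed
  moreover have "D \<subseteq> H" using D by (auto simp: H_def)
  ultimately have "int m = 1" using gen[of "int m"] m by auto
  then have H: "k \<in> H" for k using H_int[OF m(2), of k] by simp
  obtain u where u: "u \<in> P" using ne by auto
  have "k \<in> P" for k
  proof -
    have "u + (k - u) \<in> P" using H[of "k - u"] u unfolding H_def by blast
    then show ?thesis by simp
  qed
  then show ?thesis by auto
qed

text \<open>Common affine maps do not change the size of a dilate sum, so a set may be translated to
  contain 0 and divided by the gcd of its differences, which two elements make nonzero. As 0 belongs
  to \<open>A'\<close>, coprimality of the differences holds from every base point.\<close>

lemma affine_normal_form:
  fixes A :: "int set"
  assumes fin: "finite A" and "card A \<ge> 2"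
  obtains A' u g where "g > 0" "A = (\<lambda>x. u + g * x) ` A'" "finite A'"
    "\<And>h c. h > 0 \<Longrightarrow> c \<in> A' \<Longrightarrow> \<forall>x\<in>A'. h dvd x - c \<Longrightarrow> h = 1"
proof -
  obtain u v where uv: "u \<in> A" "v \<in> A" "u \<noteq> v"
    using assms(2) card_le_Suc0_iff_eq[OF fin] by (metis not_less_eq_eq numeral_2_eq_2)
  define g where "g = Gcd ((\<lambda>x. x - u) ` A)"
  have "g \<noteq> 0" using uv by (auto simp: g_def)
  moreover have "g \<ge> 0" by (simp add: g_def)
  ultimately have g: "g > 0" by simp
  have dvd: "g dvd x - u" if "x \<in> A" for x unfolding g_def using that by auto
  define A' where "A' = (\<lambda>x. (x - u) div g) ` A"
  have img: "A = (\<lambda>x. u + g * x) ` A'"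
    unfolding A'_def image_image using dvd by (simp cong: image_cong)
  have "0 \<in> A'" using uv(1) by (force simp: A'_def)
  show ?thesis
  proof (rule that[OF g img])
    show "finite A'" using fin by (simp add: A'_def)
    fix h c assume h: "(h::int) > 0" "c \<in> A'" "\<forall>x\<in>A'. h dvd x - c"
    then have "h dvd c" using \<open>0 \<in> A'\<close> by force
    then have "h dvd x" if "x \<in> A'" for x
      using h(3) that dvd_add[of h "x - c" c] by force
    then have "g * h dvd x - u" if "x \<in> A" for x
      using that by (auto simp: img)
    then have "g * h dvd g" unfolding g_def by (intro Gcd_greatest) (auto simp: g_def)
    then show "h = 1" using g h(1) dvd_times_left_cancel_iff[of g h 1] by auto
  qed
qed

text \<open>Each of the |c| residue classes meets \<open>B\<close>, and a single element of a class
  already yields \<open>card B\<close> sums.\<close>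

lemma card_dilate_sum_all_residues:
  fixes B :: "int set" and c :: int
  assumes fin: "finite B" and c: "c \<noteq> 0" and full: "\<And>u. \<exists>b\<in>B. c dvd u - b"
  shows "nat \<bar>c\<bar> * card B \<le> card (dilate_sum B c B)"
proof -
  define R where "R = (\<lambda>u. u mod c) ` {0..<\<bar>c\<bar>}"
  have inj: "inj_on (\<lambda>u. u mod c) {0..<\<bar>c\<bar>}"
  proof (rule inj_onI)
    fix u v assume uv: "u \<in> {0..<\<bar>c\<bar>}" "v \<in> {0..<\<bar>c\<bar>}" "u mod c = v mod c"
    then have "c dvd u - v" by (simp add: mod_eq_dvd_iff)
    then have "\<bar>c\<bar> dvd \<bar>u - v\<bar>" by simp
    moreover have "\<bar>u - v\<bar> < \<bar>c\<bar>" using uv by auto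
    ultimately show "u = v" 
      using zdvd_not_zless[of "\<bar>u - v\<bar>" "\<bar>c\<bar>"] by linarith
  qed
  have "card R = nat \<bar>c\<bar>" by (simp add: R_def card_image[OF inj])
  moreover have "card B \<le> card (dilate_sum {x \<in> B. x mod c = r} c B)" if r: "r \<in> R" for r
  proof (rule card_dilate_sum_ge)
    obtain u where u: "r = u mod c" using r by (auto simp: R_def)
    obtain b where "b \<in> B" "c dvd u - b" using full by blast
    then show "{x \<in> B. x mod c = r} \<noteq> {}" using u by (auto simp: mod_eq_dvd_iff dvd_diff_commute)
  qed (use fin c in auto)
  ultimately have "nat \<bar>c\<bar> * card B \<le> (\<Sum>r\<in>R. card (dilate_sum {x \<in> B. x mod c = r} c B))"
    using sum_bounded_below[of R "card B" "\<lambda>r. card (dilate_sum {x \<in> B. x mod c = r} c B)"] by auto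
  also have "\<dots> \<le> card (dilate_sum B c B)"
    by (rule card_dilate_sum_classes) (auto simp: fin R_def)
  finally show ?thesis .
qed


text \<open>A residue class with few elements can be discarded, because on its own it contributes
  card A sums. If no class is small, every class either meets all residues one level further
  down, or its sums with A reach a residue that its sums with itself miss.\<close>
lemma card_dilate_sum_step:
  fixes c :: int and l :: nat and \<rho> :: real
  assumes l: "l = nat \<bar>c\<bar>" "l \<ge> 2"
    and IH: "\<And>A. finite A \<Longrightarrow> card A \<ge> N \<Longrightarrow> \<rho> * card A \<le> card (dilate_sum A c A)"
    and \<rho>: "0 \<le> \<rho>" "\<rho> + 1 / (2 * l) \<le> l"
    and fin: "finite A" and large: "card A \<ge> 2 * l * N + 2"
    and normal: "\<And>h x. h > 0 \<Longrightarrow> x \<in> A \<Longrightarrow> \<forall>y\<in>A. h dvd y - x \<Longrightarrow> h = 1"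
  shows "(\<rho> + 1 / (2 * l)) * card A \<le> card (dilate_sum A c A)"
proof -
  have c: "c \<noteq> 0" "\<bar>c\<bar> = int l" using l by auto
  define cl where "cl r = {x \<in> A. x mod c = r}" for r
  have fin_cl: "finite (cl r)" for r using fin by (simp add: cl_def)
  define R where "R = (\<lambda>x. x mod c) ` A"
  have finR: "finite R" using fin by (simp add: R_def)
  have card_A: "card A = (\<Sum>r\<in>R. card (cl r))"
    unfolding cl_def R_def using sum.image_gen[OF fin, of "\<lambda>_. 1::nat" "\<lambda>x. x mod c"] by simp
  show ?thesis
  proof (cases "\<exists>r\<in>R. 2 * l * card (cl r) < card A")
    case True
    then obtain r where r: "r \<in> R" "2 * l * card (cl r) < card A" by auto
    define A' where "A' = A - cl r"
    have cardA': "card A' + card (cl r) = card A"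
      unfolding A'_def using fin fin_cl
      by (metis Diff_disjoint Diff_partition add.commute card_Un_disjoint cl_def finite_Diff mem_Collect_eq subsetI)
    have "4 * card (cl r) \<le> 2 * l * card (cl r)" using l(2) by simp
    then have "card A \<le> 2 * card A'" using cardA' r(2) by linarith
    moreover have "2 * N \<le> l * N" using l(2) by simp
    ultimately have "N \<le> card A'" using large by linarith
    have split: "card (dilate_sum (cl r) c A) + card (dilate_sum A' c A) \<le> card (dilate_sum A c A)"
    proof -
      have "s mod c = r" if "s \<in> dilate_sum (cl r) c A" for s
        using that by (auto simp: dilate_sum_def cl_def)
      moreover have "s mod c \<noteq> r" if "s \<in> dilate_sum A' c A" for s
        using that by (auto simp: dilate_sum_def cl_def A'_def)
      ultimately have "dilate_sum (cl r) c A \<inter> dilate_sum A' c A = {}" by blast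
      then have "card (dilate_sum (cl r) c A) + card (dilate_sum A' c A)
          = card (dilate_sum (cl r) c A \<union> dilate_sum A' c A)"
        using fin fin_cl by (simp add: card_Un_disjoint A'_def)
      also have "\<dots> \<le> card (dilate_sum A c A)"
        by (intro card_mono Un_least dilate_sum_mono) (auto simp: fin cl_def A'_def)
      finally show ?thesis .
    qed
    have "card A \<le> card (dilate_sum (cl r) c A)"
      by (rule card_dilate_sum_ge) (use fin fin_cl r c in \<open>auto simp: R_def cl_def\<close>)
    moreover have "\<rho> * card A' \<le> card (dilate_sum A' c A)"
    proof -
      have "\<rho> * card A' \<le> card (dilate_sum A' c A')"
        using \<open>N \<le> card A'\<close> fin by (intro IH) (auto simp: A'_def)
      also have "card (dilate_sum A' c A') \<le> card (dilate_sum A' c A)"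
        by (intro card_mono dilate_sum_mono finite_dilate_sum) (auto simp: fin A'_def)
      finally show ?thesis by simp
    qed
    ultimately have main: "card A + \<rho> * card A' \<le> card (dilate_sum A c A)"
      using split by linarith
    \<comment> \<open>The small class brings \<open>card A\<close> sums. Half of them replace the
      lost \<rho> * \<open>card (cl r)\<close>, since \<rho> \<le> l; the other half covers the
      increment 1 / (2 l).\<close>
    have "\<rho> * card (cl r) \<le> real l * card (cl r)"
      using \<rho> by (intro mult_right_mono) (auto intro: order_trans[rotated])
    also have "\<dots> \<le> card A / 2" using r(2) by (simp flip: of_nat_mult)
    finally have 1: "\<rho> * card (cl r) \<le> card A / 2" .
    have "1 / (2 * real l) * card A \<le> 1 / 2 * card A"
      using l(2) by (intro mult_right_mono) (auto simp: field_simps)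
    moreover have "\<rho> * card A = \<rho> * card A' + \<rho> * card (cl r)"
      using cardA' by (metis distrib_left of_nat_add)
    ultimately show ?thesis using main 1 by (simp add: distrib_right)
  next
    case False
    then have big: "card A \<le> 2 * l * card (cl r)" if "r \<in> R" for r
      using that by (auto simp: not_less)
    have part: "(\<rho> + 1 / (2 * l)) * card (cl r) \<le> card (dilate_sum (cl r) c A)" if r: "r \<in> R" for r
    proof -
      obtain x0 where x0: "x0 \<in> cl r" using r by (auto simp: R_def cl_def)
      have x0A: "x0 \<in> A" using x0 by (simp add: cl_def)
      define B where "B = (\<lambda>x. (x - x0) div c) ` cl r"
      have dvd: "c dvd x - x0" if "x \<in> cl r" for x
        using that x0 by (auto simp: cl_def mod_eq_dvd_iff[symmetric])
      have clB: "cl r = (\<lambda>b. x0 + c * b) ` B"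
        unfolding B_def image_image using dvd by (simp cong: image_cong)
      have finB: "finite B" by (simp add: B_def fin_cl)
      have cardB: "card B = card (cl r)"
        unfolding clB using c by (simp add: card_image inj_on_def)
      have sumB: "card (dilate_sum (cl r) c (cl r)) = card (dilate_sum B c B)"
        unfolding clB using c by (simp add: card_dilate_sum_affine)
      have sub: "dilate_sum (cl r) c (cl r) \<subseteq> dilate_sum (cl r) c A"
        by (intro dilate_sum_mono) (auto simp: cl_def)
      \<comment> \<open>With \<open>cl r\<close> = x0 + c B, \<open>P\<close> records the residues
        occurring one level further down. Unless it is everything, it cannot be invariant under all
        translations x - x0 with x in \<open>A\<close>, because these have gcd 1.\<close>
      define P where "P = {u. \<exists>b\<in>B. c dvd u - b}"
      show ?thesis
      proof (cases "P = UNIV")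
        case True
        then have "nat \<bar>c\<bar> * card B \<le> card (dilate_sum B c B)"
          by (intro card_dilate_sum_all_residues) (auto simp: finB c P_def)
        moreover have "card (dilate_sum B c B) \<le> card (dilate_sum (cl r) c A)"
          unfolding sumB[symmetric] by (intro card_mono sub finite_dilate_sum fin fin_cl)
        ultimately have "real l * card (cl r) \<le> card (dilate_sum (cl r) c A)"
          using l cardB by (metis of_nat_le_iff of_nat_mult order_trans)
        moreover have "(\<rho> + 1 / (2 * l)) * card (cl r) \<le> real l * card (cl r)"
          using \<rho> by (intro mult_right_mono) auto
        ultimately show ?thesis by linarith
      next
        case False
        have "\<exists>u\<in>P. \<exists>x\<in>A. u + (x - x0) \<notin> P"
        proof (rule ccontr)
          assume *: "\<not> ?thesis"
          have "P = UNIV"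
          proof (rule periods_generate)
            show "int l > 0" using l by simp
            show "u + int l * k \<in> P" if u: "u \<in> P" for u k
            proof -
              obtain b where "b \<in> B" "c dvd u - b" using u by (auto simp: P_def)
              moreover have "c dvd int l * k" using c(2) by (metis abs_dvd_iff dvd_triv_left)
              ultimately have "c dvd (u - b) + int l * k" by (intro dvd_add)
              then show ?thesis using \<open>b \<in> B\<close> by (auto simp: P_def algebra_simps)
            qed
            show "u + d \<in> P" if "u \<in> P" "d \<in> (\<lambda>x. x - x0) ` A" for u d
              using that * by auto
            show "h = 1" if "h > 0" "\<forall>d\<in>(\<lambda>x. x - x0) ` A. h dvd d" for h
              using normal[of h x0] that x0A by auto
            show "P \<noteq> {}" using x0 by (force simp: P_def B_def)
          qed
          with False show False by simp
        qed
        then obtain u x where ux: "u \<in> P" "x \<in> A" "u + (x - x0) \<notin> P" by auto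
        from ux(1) obtain b where b: "b \<in> B" "c dvd u - b" by (auto simp: P_def)
        have xb: "b + (x - x0) \<notin> P"
        proof
          assume "b + (x - x0) \<in> P"
          then obtain b' where "b' \<in> B" "c dvd b + (x - x0) - b'" by (auto simp: P_def)
          then have "c dvd (u - b) + (b + (x - x0) - b')" by (intro dvd_add b)
          then show False using ux \<open>b' \<in> B\<close> by (auto simp: P_def algebra_simps)
        qed
        define s where "s = x mod c"
        \<comment> \<open>After subtracting x0 and dividing by \<open>c\<close>, sums of
          \<open>cl r\<close> with itself fall into P + x0, whereas b + y with y congruent to x does
          not. So \<open>E\<close> consists of new sums, and \<open>cl s\<close> not being small
          makes it large.\<close>
        define E where "E = (\<lambda>y. x0 + c * b + c * y) ` cl s"
        have E_sub: "E \<subseteq> dilate_sum (cl r) c A"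
        proof
          fix e assume "e \<in> E"
          then obtain y where "y \<in> cl s" "e = (x0 + c * b) + c * y" by (auto simp: E_def)
          moreover have "x0 + c * b \<in> cl r" unfolding clB using b(1) by (rule imageI)
          ultimately show "e \<in> dilate_sum (cl r) c A"
            using dilate_sum_memI[of "x0 + c * b" "cl r" y A c] by (simp add: cl_def)
        qed
        have disj: "E \<inter> dilate_sum (cl r) c (cl r) = {}"
        proof (rule ccontr)
          assume "\<not> ?thesis"
          then obtain y b1 b2 where y: "y \<in> cl s" "b1 \<in> B" "b2 \<in> B"
            and eq: "x0 + c * b + c * y = x0 + c * b1 + c * (x0 + c * b2)"
            by (auto simp: E_def dilate_sum_def clB)
          have "c * (b + y) = c * (b1 + x0 + c * b2)" using eq by (simp add: algebra_simps)
          then have "b + y = b1 + x0 + c * b2" using c by simp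
          then have "b + (x - x0) - b1 = (x - y) + c * b2" by simp
          moreover have "c dvd (x - y) + c * b2"
            using y(1) by (intro dvd_add) (simp_all add: cl_def s_def mod_eq_dvd_iff[symmetric])
          ultimately have "c dvd b + (x - x0) - b1" by metis
          then show False using xb y(2) by (auto simp: P_def)
        qed
        have "card E = card (cl s)" unfolding E_def using c by (simp add: card_image inj_on_def)
        moreover have "s \<in> R" using ux by (simp add: s_def R_def)
        ultimately have E_card: "card A \<le> 2 * l * card E" using big[of s] by simp
        have "card E + card (dilate_sum (cl r) c (cl r)) = card (E \<union> dilate_sum (cl r) c (cl r))"
          using disj fin_cl by (simp add: card_Un_disjoint E_def)
        also have "\<dots> \<le> card (dilate_sum (cl r) c A)"
          by (intro card_mono Un_least E_sub sub finite_dilate_sum fin fin_cl)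
        finally have "card E + card (dilate_sum (cl r) c (cl r)) \<le> card (dilate_sum (cl r) c A)" .
        moreover have "\<rho> * card (cl r) \<le> card (dilate_sum (cl r) c (cl r))"
        proof (rule IH[OF fin_cl])
          have "2 * l * N \<le> 2 * l * card (cl r)" using big[OF r] large by linarith
          then show "N \<le> card (cl r)" using l by simp
        qed
        moreover have "1 / (2 * l) * card (cl r) \<le> card E"
        proof -
          have "card (cl r) \<le> card A" by (intro card_mono fin) (auto simp: cl_def)
          then have "card (cl r) \<le> 2 * l * card E" using E_card by simp
          then have "real (card (cl r)) \<le> 2 * l * card E" by (metis of_nat_le_iff of_nat_mult of_nat_numeral)
          then show ?thesis using l by (simp add: field_simps)
        qed
        ultimately show ?thesis by (simp add: distrib_right)
      qed
    qed
    have "(\<rho> + 1 / (2 * l)) * card A = (\<Sum>r\<in>R. (\<rho> + 1 / (2 * l)) * card (cl r))"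
      by (simp add: card_A sum_distrib_left)
    also have "\<dots> \<le> (\<Sum>r\<in>R. card (dilate_sum (cl r) c A))"
      unfolding of_nat_sum by (intro sum_mono part)
    also have "(\<Sum>r\<in>R. card (dilate_sum (cl r) c A)) \<le> card (dilate_sum A c A)"
      unfolding cl_def by (rule card_dilate_sum_classes[OF fin fin finR])
    finally show ?thesis by simp
  qed
qed

text \<open>Starting from the trivial constant 0, each use of \<open>card_dilate_sum_step\<close>
  gains 1 / (2 l) with l = |c| and raises the threshold from N to 2 l N + 2; after 2 l^2 rounds the
  constant is l. The step needs normalised sets, which \<open>affine_normal_form\<close> supplies
  without changing either cardinality.\<close>

lemma card_dilate_sum_lower_bound:
  fixes c :: int
  assumes "\<bar>c\<bar> \<ge> 2"
  shows "\<exists>N. \<forall>A. finite A \<longrightarrow> N \<le> card A \<longrightarrow> \<bar>c\<bar> * card A \<le> card (dilate_sum A c A)"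
proof -
  define l where "l = nat \<bar>c\<bar>"
  have l: "l = nat \<bar>c\<bar>" "l \<ge> 2" using assms by (auto simp: l_def)
  have "\<exists>N. \<forall>A. finite A \<longrightarrow> N \<le> card A \<longrightarrow> j / (2 * l) * card A \<le> card (dilate_sum A c A)"
    if "j \<le> 2 * l * l" for j
    using that
  proof (induction j)
    case 0
    then show ?case by auto
  next
    case (Suc j)
    then obtain N where N: "\<And>A. finite A \<Longrightarrow> N \<le> card A \<Longrightarrow> j / (2 * l) * card A \<le> card (dilate_sum A c A)"
      by auto
    have \<rho>: "Suc j / (2 * l) = j / (2 * l) + 1 / (2 * l)" by (simp add: add_divide_distrib)
    have "real (Suc j) \<le> 2 * l * l" using Suc.prems by (metis of_nat_le_iff of_nat_mult of_nat_numeral)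
    then have \<rho>l: "j / (2 * l) + 1 / (2 * l) \<le> l"
      unfolding \<rho>[symmetric] using l by (simp add: divide_le_eq mult.commute)
    have "Suc j / (2 * l) * card A \<le> card (dilate_sum A c A)"
      if A: "finite A" "2 * l * N + 2 \<le> card A" for A
    proof -
      obtain A' u g where g: "g > 0" "A = (\<lambda>x. u + g * x) ` A'" "finite A'"
        and normal: "\<And>h c. h > 0 \<Longrightarrow> c \<in> A' \<Longrightarrow> \<forall>x\<in>A'. h dvd x - c \<Longrightarrow> h = 1"
        using affine_normal_form[OF A(1)] A(2) by (metis add_leD2)
      have "card A = card A'" unfolding g(2) using g(1) by (simp add: card_image inj_on_def)
      moreover have "card (dilate_sum A c A) = card (dilate_sum A' c A')"
        unfolding g(2) using g(1) by (simp add: card_dilate_sum_affine)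
      moreover have "(j / (2 * l) + 1 / (2 * l)) * card A' \<le> card (dilate_sum A' c A')"
        by (rule card_dilate_sum_step[OF l N]) (use \<rho>l g A normal \<open>card A = card A'\<close> in auto)
      ultimately show ?thesis using \<rho> by simp
    qed
    then show ?case by blast
  qed
  from this[of "2 * l * l"] obtain N where
    N: "\<And>A. finite A \<Longrightarrow> N \<le> card A \<Longrightarrow> real (2 * l * l) / (2 * l) * card A \<le> card (dilate_sum A c A)"
    by auto
  have "\<bar>c\<bar> * card A \<le> card (dilate_sum A c A)" if "finite A" "N \<le> card A" for A
  proof -
    have "real l * card A \<le> card (dilate_sum A c A)" using N[OF that] l by simp
    then have "l * card A \<le> card (dilate_sum A c A)" by (metis of_nat_le_iff of_nat_mult)
    then show ?thesis using l by (metis abs_ge_zero int_nat_eq of_nat_mono of_nat_mult)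
  qed
  then show ?thesis by blast
qed

section \<open>Graded solutions\<close>

text \<open>The pairs with x = \<open>Min X\<close> or y = \<open>Max Y\<close> form a chain: y
  climbs to \<open>Max Y\<close> first, then x climbs. The sum strictly increases along it, so each
  element of \<open>W\<close> is hit at most once.\<close>

lemma card_sums_hook:
  fixes X Y W :: "int set"
  assumes fin: "finite X" "finite Y" "finite W" and X: "X \<noteq> {}" and Y: "Y \<noteq> {}"
  shows "card {(x, y). x \<in> X \<and> y \<in> Y \<and> x + y \<in> W}
    \<le> card W + card {(x, y). x \<in> X - {Min X} \<and> y \<in> Y - {Max Y} \<and> x + y \<in> W}"
    (is "card ?A \<le> card W + card ?B")
proof -
  have min: "Min X \<le> x" if "x \<in> X" for x using fin that by simp
  have max: "y \<le> Max Y" if "y \<in> Y" for y using fin that by simp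
  have finA: "finite ?A"
    by (rule finite_subset[of _ "X \<times> Y"]) (use fin in auto)
  have "card (?A - ?B) \<le> card W"
  proof (rule card_inj_on_le[where f = "\<lambda>(x, y). x + y"])
    show "inj_on (\<lambda>(x, y). x + y) (?A - ?B)"
    proof (rule inj_onI)
      fix p q assume *: "p \<in> ?A - ?B" "q \<in> ?A - ?B" "(\<lambda>(x, y). x + y) p = (\<lambda>(x, y). x + y) q"
      obtain x y x' y' where pq: "p = (x, y)" "q = (x', y')" by (metis surj_pair)
      have "x \<in> X" "y \<in> Y" "x' \<in> X" "y' \<in> Y" "x + y = x' + y'"
        "x = Min X \<or> y = Max Y" "x' = Min X \<or> y' = Max Y"
        using * pq by auto
      then show "p = q"
        using min[of x] min[of x'] max[of y] max[of y'] pq by auto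
    qed
  qed (use fin in auto)
  moreover have "card ?A \<le> card (?A - ?B) + card ?B"
  proof -
    have "finite ?B" by (rule finite_subset[OF _ finA]) auto
    then have "card ?A \<le> card ((?A - ?B) \<union> ?B)" using finA by (intro card_mono) auto
    also have "\<dots> \<le> card (?A - ?B) + card ?B" by (rule card_Un_le)
    finally show ?thesis .
  qed
  ultimately show ?thesis by linarith
qed

text \<open>Each hook made of the smallest element of X and the largest element of Y carries
  pairwise distinct sums; removing it leaves a grid with both sides shorter by one.\<close>
lemma card_sums_in_le:
  fixes X Y W :: "int set"
  assumes "finite X" "finite Y" "finite W" "t \<le> card X" "t \<le> card Y"
  shows "card {(x, y). x \<in> X \<and> y \<in> Y \<and> x + y \<in> W} \<le> t * card W + (card X - t) * (card Y - t)"
  using assms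
proof (induction t arbitrary: X Y)
  case 0
  have "card {(x, y). x \<in> X \<and> y \<in> Y \<and> x + y \<in> W} \<le> card (X \<times> Y)"
    by (rule card_mono) (use 0 in auto)
  then show ?case by (simp add: card_cartesian_product)
next
  case (Suc t)
  from Suc.prems have ne: "X \<noteq> {}" "Y \<noteq> {}" by auto
  have c: "card (X - {Min X}) = card X - 1" "card (Y - {Max Y}) = card Y - 1"
    using Suc.prems ne by auto
  have "card {(x, y). x \<in> X \<and> y \<in> Y \<and> x + y \<in> W}
      \<le> card W + card {(x, y). x \<in> X - {Min X} \<and> y \<in> Y - {Max Y} \<and> x + y \<in> W}"
    using Suc.prems ne by (intro card_sums_hook)
  also have "\<dots> \<le> card W + (t * card W + (card (X - {Min X}) - t) * (card (Y - {Max Y}) - t))"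
    by (intro add_left_mono Suc.IH) (use Suc.prems c in auto)
  also have "\<dots> = Suc t * card W + (card X - Suc t) * (card Y - Suc t)"
    using c by simp
  finally show ?case .
qed

text \<open>Choosing the number of hooks near p - m/2 balances the two terms.\<close>
lemma card_sums_in_le_quadratic:
  fixes X W :: "int set"
  assumes fin: "finite X" "finite W"
  obtains m :: real where "0 \<le> m" "m \<le> card W"
    "card {(x, y). x \<in> X \<and> y \<in> X \<and> x + y \<in> W} \<le> card X * m - m\<^sup>2 / 4 + 1 / 4"
proof (cases "card W \<le> 2 * card X")
  case True
  \<comment> \<open>Using \<open>card X - k\<close> hooks leaves a k by k grid. Rounding half of
    \<open>card W\<close> down costs exactly 1/4 when \<open>card W\<close> is odd.\<close>
  define k where "k = card W div 2"
  have k: "k \<le> card X" using True by (simp add: k_def)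
  have "card {(x, y). x \<in> X \<and> y \<in> X \<and> x + y \<in> W}
      \<le> (card X - k) * card W + (card X - (card X - k)) * (card X - (card X - k))"
    by (rule card_sums_in_le) (use fin in auto)
  from of_nat_mono[OF this, where ?'a = real]
  have "real (card {(x, y). x \<in> X \<and> y \<in> X \<and> x + y \<in> W})
      \<le> real ((card X - k) * card W + k * k)"
    using k by simp
  also have "\<dots> = (real (card X) - k) * card W + real k * real k"
    using k by (simp add: of_nat_diff)
  also have "\<dots> \<le> card X * real (card W) - (real (card W))\<^sup>2 / 4 + 1 / 4"
  proof -
    have "card W = 2 * k \<or> card W = 2 * k + 1" unfolding k_def by linarith
    then show ?thesis by (auto simp: algebra_simps power2_eq_square)
  qed
  finally show ?thesis using that[of "card W"] by simp
next
  case False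
  \<comment> \<open>The quadratic in \<open>m\<close> peaks at 2 * \<open>card X\<close>, where it
    equals the trivial count; for larger \<open>W\<close> the value of \<open>m\<close> stops there.
    This is why \<open>m\<close> is only bounded by \<open>card W\<close>.\<close>
  have "card {(x, y). x \<in> X \<and> y \<in> X \<and> x + y \<in> W} \<le> 0 * card W + (card X - 0) * (card X - 0)"
    by (rule card_sums_in_le) (use fin in auto)
  then have "card {(x, y). x \<in> X \<and> y \<in> X \<and> x + y \<in> W} \<le> card X * card X" by simp
  from of_nat_mono[OF this, where ?'a = real]
  have "real (card {(x, y). x \<in> X \<and> y \<in> X \<and> x + y \<in> W}) \<le> real (card X) * real (card X)"
    by simp
  also have "\<dots> \<le> card X * (2 * real (card X)) - (2 * real (card X))\<^sup>2 / 4 + 1 / 4"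
    by (simp add: power2_eq_square)
  finally show ?thesis using that[of "2 * card X"] False by simp
qed

text \<open>If the largest of the m i is attained at j, then every product s (i + 1) * m i is charged to
  a level other than j, at the price m j per unit of weight.\<close>
lemma sum_consecutive_levels_le:
  fixes s m :: "int \<Rightarrow> real" and I :: "int set"
  assumes fin: "finite I" and s0: "\<And>i. i \<notin> I \<Longrightarrow> s i = 0"
    and m: "\<And>i. 0 \<le> m i" "\<And>i. m i \<le> s i"
  shows "(\<Sum>i\<in>I. s (i + 1) * m i - (m i)\<^sup>2 / 4) \<le> (\<Sum>i\<in>I. s i)\<^sup>2 / 5"
proof (cases "I = {}")
  case False
  have "Max (m ` I) \<in> m ` I" using fin False by (intro Max_in) auto
  then obtain j where j: "j \<in> I" "m j = Max (m ` I)" by auto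
  have m0: "m i = 0" if "i \<notin> I" for i using m[of i] s0[OF that] by simp
  have mj: "m i \<le> m j" for i
  proof (cases "i \<in> I")
    case True
    then show ?thesis using fin by (simp add: j)
  qed (use m m0 in auto)
  have shift: "(\<Sum>i\<in>I'. f (i + 1)) \<le> (\<Sum>i\<in>J. f i)"
    if "I' \<subseteq> I" "(\<lambda>i. i + 1) ` I' \<inter> I \<subseteq> J" "J \<subseteq> I" "\<And>i. 0 \<le> f i" "\<And>i. i \<notin> I \<Longrightarrow> f i = 0"
    for I' J :: "int set" and f :: "int \<Rightarrow> real"
  proof -
    have fI': "finite I'" using that(1) fin by (rule finite_subset)
    have "(\<Sum>i\<in>I'. f (i + 1)) = (\<Sum>i\<in>(\<lambda>i. i + 1) ` I'. f i)"
      by (simp add: sum.reindex)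
    also have "\<dots> = (\<Sum>i\<in>(\<lambda>i. i + 1) ` I' \<inter> I. f i)"
      by (rule sum.mono_neutral_right) (use fI' that in auto)
    also have "\<dots> \<le> (\<Sum>i\<in>J. f i)"
      by (rule sum_mono2) (use that fin finite_subset in auto)
    finally show ?thesis .
  qed
  define e where "e i = s i - m i" for i
  have e: "0 \<le> e i" "i \<notin> I \<Longrightarrow> e i = 0" for i using m[of i] m0[of i] s0[of i] by (auto simp: e_def)
  \<comment> \<open>For i < j the product m (i + 1) * m i is charged to level i, for i \<ge> j to
    level i + 1. Level j thus carries only its excess e j, and the total weight is the sum of
    \<open>s\<close> minus m j.\<close>
  define L where "L = {i\<in>I. i < j}"
  define U where "U = {i\<in>I. i \<ge> j}"
  have split: "I = L \<union> U" "L \<inter> U = {}" "finite L" "finite U" using fin by (auto simp: L_def U_def)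
  have "(\<Sum>i\<in>I. s (i + 1) * m i) \<le> (\<Sum>i\<in>I. m j * e (i + 1)) + (\<Sum>i\<in>I. m (i + 1) * m i)"
    unfolding sum.distrib[symmetric]
  proof (rule sum_mono)
    fix i
    have "e (i + 1) * m i \<le> e (i + 1) * m j" using e mj by (intro mult_left_mono) auto
    then show "s (i + 1) * m i \<le> m j * e (i + 1) + m (i + 1) * m i"
      by (simp add: e_def algebra_simps)
  qed
  also have "(\<Sum>i\<in>I. m (i + 1) * m i) = (\<Sum>i\<in>L. m (i + 1) * m i) + (\<Sum>i\<in>U. m (i + 1) * m i)"
    using sum.union_disjoint[OF split(3,4,2), of "\<lambda>i. m (i + 1) * m i"] split(1) by simp
  also have "(\<Sum>i\<in>L. m (i + 1) * m i) \<le> (\<Sum>i\<in>L. m j * m i)"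
    by (intro sum_mono mult_right_mono mj m)
  also have "(\<Sum>i\<in>U. m (i + 1) * m i) \<le> (\<Sum>i\<in>U. m j * m (i + 1))"
    by (intro sum_mono) (metis mult.commute mult_right_mono mj m(1))
  also have "(\<Sum>i\<in>I. m j * e (i + 1)) + ((\<Sum>i\<in>L. m j * m i) + (\<Sum>i\<in>U. m j * m (i + 1)))
      = m j * ((\<Sum>i\<in>I. e (i + 1)) + (\<Sum>i\<in>L. m i) + (\<Sum>i\<in>U. m (i + 1)))"
    by (simp add: sum_distrib_left algebra_simps)
  also have "\<dots> \<le> m j * ((\<Sum>i\<in>I. s i) - m j)"
  proof (rule mult_left_mono[OF _ m(1)])
    have "(\<Sum>i\<in>I. e (i + 1)) \<le> (\<Sum>i\<in>I. e i)"
      by (rule shift) (use e in auto)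
    moreover have "(\<Sum>i\<in>U. m (i + 1)) \<le> (\<Sum>i\<in>U - {j}. m i)"
      by (rule shift) (use m m0 in \<open>auto simp: U_def\<close>)
    moreover have "(\<Sum>i\<in>U. m i) = m j + (\<Sum>i\<in>U - {j}. m i)"
      by (rule sum.remove) (use split j in \<open>auto simp: U_def\<close>)
    moreover have "(\<Sum>i\<in>I. m i) = (\<Sum>i\<in>L. m i) + (\<Sum>i\<in>U. m i)"
      using sum.union_disjoint[OF split(3,4,2), of m] split(1) by simp
    moreover have "(\<Sum>i\<in>I. e i) = (\<Sum>i\<in>I. s i) - (\<Sum>i\<in>I. m i)"
      by (simp add: e_def sum_subtractf)
    ultimately show "(\<Sum>i\<in>I. e (i + 1)) + (\<Sum>i\<in>L. m i) + (\<Sum>i\<in>U. m (i + 1)) \<le> (\<Sum>i\<in>I. s i) - m j"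
      by linarith
  qed
  finally have 1: "(\<Sum>i\<in>I. s (i + 1) * m i) \<le> m j * ((\<Sum>i\<in>I. s i) - m j)" by simp
  have 2: "(m j)\<^sup>2 / 4 \<le> (\<Sum>i\<in>I. (m i)\<^sup>2 / 4)"
    by (rule member_le_sum) (use j fin in auto)
  \<comment> \<open>Completing the square gives the constant 1/5, with equality at m j = 2 n / 5,
    the share of the smaller interval in the extremal sets.\<close>
  have "m j * (n - m j) - (m j)\<^sup>2 / 4 \<le> n\<^sup>2 / 5" for n
  proof -
    have "0 \<le> 5 * (m j / 2 - n / 5)\<^sup>2" by simp
    then show ?thesis by (simp add: power2_eq_square algebra_simps)
  qed
  from this[of "\<Sum>i\<in>I. s i"] 1 2 show ?thesis by (simp add: sum_subtractf)
qed simp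

definition solutions :: "int \<Rightarrow> int set \<Rightarrow> (int \<times> int \<times> int) set" where
  "solutions a S = {(x, y, z). x \<in> S \<and> y \<in> S \<and> z \<in> S \<and> x + y + a * z = 0}"

lemma finite_solutions [simp]: "finite S \<Longrightarrow> finite (solutions a S)"
  by (rule finite_subset[of _ "S \<times> S \<times> S"]) (auto simp: solutions_def)

lemma inj_on_solutions:
  assumes "a \<noteq> 0"
  shows "inj_on (\<lambda>(x, y, z). (x, y)) (solutions a S)"
proof -
  have "z = z'" if "x + y + a * z = 0" "x + y + a * z' = 0" for x y z z'
    using that assms by (metis add_left_imp_eq mult_left_cancel)
  then show ?thesis by (force simp: inj_on_def solutions_def)
qed

text \<open>Sorted by i = \<open>lev z\<close>, the solutions become pairs from level i + 1 whose
  sum lies in -a times level i, so \<open>card_sums_in_le_quadratic\<close> applies to each i and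
  \<open>sum_consecutive_levels_le\<close> to the total. The linear term collects a rounding error
  of 1/4 from each of at most \<open>card S\<close> levels.\<close>

lemma card_graded_solutions_le:
  fixes lev :: "int \<Rightarrow> int" and S :: "int set"
  assumes fin: "finite S" and a: "a \<noteq> 0"
  shows "card {(x, y, z) \<in> solutions a S. lev x = lev z + 1 \<and> lev y = lev z + 1}
    \<le> (real (card S))\<^sup>2 / 5 + card S / 4"
proof -
  define G where "G = {(x, y, z) \<in> solutions a S. lev x = lev z + 1 \<and> lev y = lev z + 1}"
  have finG: "finite G" unfolding G_def by (rule finite_subset[OF _ finite_solutions[OF fin]]) auto
  define I where "I = lev ` S"
  have finI: "finite I" using fin by (simp add: I_def)
  define X where "X i = {x \<in> S. lev x = i}" for i
  have finX: "finite (X i)" for i using fin by (simp add: X_def)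
  define W where "W i = (\<lambda>z. - (a * z)) ` X i" for i
  have cardW: "card (W i) = card (X i)" for i
    unfolding W_def by (rule card_image) (simp add: inj_on_def a)
  have "\<exists>m::real. 0 \<le> m \<and> m \<le> card (X i) \<and>
    card {(x, y). x \<in> X (i + 1) \<and> y \<in> X (i + 1) \<and> x + y \<in> W i} \<le> card (X (i + 1)) * m - m\<^sup>2 / 4 + 1 / 4" for i
  proof -
    have "finite (W i)" using finX by (simp add: W_def)
    from card_sums_in_le_quadratic[OF finX[of "i + 1"] this] obtain m :: real where
      "0 \<le> m" "m \<le> card (W i)"
      "card {(x, y). x \<in> X (i + 1) \<and> y \<in> X (i + 1) \<and> x + y \<in> W i} \<le> card (X (i + 1)) * m - m\<^sup>2 / 4 + 1 / 4" .
    then show ?thesis unfolding cardW by (intro exI[of _ m] conjI)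
  qed
  from choice[OF allI[OF this]] obtain m :: "int \<Rightarrow> real" where
    mi: "\<forall>i. 0 \<le> m i \<and> m i \<le> card (X i) \<and>
      card {(x, y). x \<in> X (i + 1) \<and> y \<in> X (i + 1) \<and> x + y \<in> W i}
       \<le> card (X (i + 1)) * m i - (m i)\<^sup>2 / 4 + 1 / 4" ..
  note m = mi[rule_format, THEN conjunct1] mi[rule_format, THEN conjunct2, THEN conjunct1]
    mi[rule_format, THEN conjunct2, THEN conjunct2]
  have cardS: "card S = (\<Sum>i\<in>I. card (X i))"
    unfolding I_def X_def using sum.image_gen[OF fin, of "\<lambda>_. 1::nat" lev] by simp
  have "real (card G) = (\<Sum>i\<in>I. real (card {p \<in> G. lev (snd (snd p)) = i}))"
  proof -
    have "card G = (\<Sum>i\<in>(\<lambda>p. lev (snd (snd p))) ` G. card {p \<in> G. lev (snd (snd p)) = i})"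
      using sum.image_gen[OF finG, of "\<lambda>_. 1::nat" "\<lambda>p. lev (snd (snd p))"] by simp
    also have "\<dots> = (\<Sum>i\<in>I. card {p \<in> G. lev (snd (snd p)) = i})"
    proof (rule sum.mono_neutral_left)
      show "(\<lambda>p. lev (snd (snd p))) ` G \<subseteq> I" by (auto simp: G_def I_def solutions_def)
      show "\<forall>i\<in>I - (\<lambda>p. lev (snd (snd p))) ` G. card {p \<in> G. lev (snd (snd p)) = i} = 0"
      proof
        fix i assume "i \<in> I - (\<lambda>p. lev (snd (snd p))) ` G"
        then have "{p \<in> G. lev (snd (snd p)) = i} = {}" by blast
        then show "card {p \<in> G. lev (snd (snd p)) = i} = 0" by (simp only: card.empty)
      qed
    qed fact
    finally show ?thesis by simp
  qed
  also have "\<dots> \<le> (\<Sum>i\<in>I. card (X (i + 1)) * m i - (m i)\<^sup>2 / 4 + 1 / 4)"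
  proof (rule sum_mono)
    fix i
    have "card {p \<in> G. lev (snd (snd p)) = i}
        \<le> card {(x, y). x \<in> X (i + 1) \<and> y \<in> X (i + 1) \<and> x + y \<in> W i}"
    proof (rule card_inj_on_le[where f = "\<lambda>(x, y, z). (x, y)"])
      show "inj_on (\<lambda>(x, y, z). (x, y)) {p \<in> G. lev (snd (snd p)) = i}"
        by (rule inj_on_subset[OF inj_on_solutions[OF a, of S]]) (auto simp: G_def)
      show "(\<lambda>(x, y, z). (x, y)) ` {p \<in> G. lev (snd (snd p)) = i}
          \<subseteq> {(x, y). x \<in> X (i + 1) \<and> y \<in> X (i + 1) \<and> x + y \<in> W i}"
        by (auto simp: G_def solutions_def X_def W_def image_iff eq_neg_iff_add_eq_0)
      show "finite {(x, y). x \<in> X (i + 1) \<and> y \<in> X (i + 1) \<and> x + y \<in> W i}"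
        by (rule finite_subset[of _ "X (i + 1) \<times> X (i + 1)"]) (use finX in auto)
    qed
    then show "real (card {p \<in> G. lev (snd (snd p)) = i}) \<le> card (X (i + 1)) * m i - (m i)\<^sup>2 / 4 + 1 / 4"
      using m(3)[of i] by linarith
  qed
  also have "\<dots> = (\<Sum>i\<in>I. card (X (i + 1)) * m i - (m i)\<^sup>2 / 4) + card I / 4"
    by (simp add: sum.distrib)
  also have "\<dots> \<le> (\<Sum>i\<in>I. real (card (X i)))\<^sup>2 / 5 + card S / 4"
  proof (rule add_mono)
    show "(\<Sum>i\<in>I. card (X (i + 1)) * m i - (m i)\<^sup>2 / 4) \<le> (\<Sum>i\<in>I. real (card (X i)))\<^sup>2 / 5"
    proof (rule sum_consecutive_levels_le)
      fix i assume "i \<notin> I"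
      then have "X i = {}" by (auto simp: X_def I_def)
      then show "real (card (X i)) = 0" by simp
    qed (use finI m in auto)
    show "real (card I) / 4 \<le> card S / 4"
      using card_image_le[OF fin, of lev] by (simp add: I_def)
  qed
  also have "(\<Sum>i\<in>I. real (card (X i))) = card S" by (simp add: cardS)
  finally show ?thesis by (simp add: G_def)
qed

section \<open>Commensurability\<close>

text \<open>A real multiplier lets a relation be traversed backwards, with the inverse factor.
  Differences are used because their factors simply multiply in the triangle inequality; A + c B is
  recovered with multiplier -c.\<close>

definition dil_diff :: "int set \<Rightarrow> real \<Rightarrow> int set \<Rightarrow> real set" where
  "dil_diff A \<mu> B = (\<lambda>(x, y). real_of_int x - \<mu> * real_of_int y) ` (A \<times> B)"

lemma finite_dil_diff [simp]: "finite A \<Longrightarrow> finite B \<Longrightarrow> finite (dil_diff A \<mu> B)"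
  by (simp add: dil_diff_def)

lemma dil_diff_memI: "x \<in> A \<Longrightarrow> y \<in> B \<Longrightarrow> real_of_int x - \<mu> * real_of_int y \<in> dil_diff A \<mu> B"
  by (force simp: dil_diff_def)

text \<open>Ruzsa's triangle inequality: an element x - \<mu> \<nu> z has card B representations as
  (x - \<mu> y) + \<mu> (y - \<nu> z).\<close>
lemma card_dil_diff_triangle:
  assumes fin: "finite A" "finite B" "finite C" and \<mu>: "\<mu> \<noteq> 0"
  shows "card (dil_diff A (\<mu> * \<nu>) C) * card B \<le> card (dil_diff A \<mu> B) * card (dil_diff B \<nu> C)"
proof -
  have "\<forall>d\<in>dil_diff A (\<mu> * \<nu>) C. \<exists>p. fst p \<in> A \<and> snd p \<in> C \<and>
      d = real_of_int (fst p) - \<mu> * \<nu> * real_of_int (snd p)"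
    by (auto simp: dil_diff_def)
  then obtain f where f: "\<And>d. d \<in> dil_diff A (\<mu> * \<nu>) C \<Longrightarrow> fst (f d) \<in> A \<and> snd (f d) \<in> C \<and>
      d = real_of_int (fst (f d)) - \<mu> * \<nu> * real_of_int (snd (f d))"
    by metis
  define h where "h = (\<lambda>(d, b). (real_of_int (fst (f d)) - \<mu> * real_of_int b,
      real_of_int b - \<nu> * real_of_int (snd (f d))))"
  have "card (dil_diff A (\<mu> * \<nu>) C \<times> B) \<le> card (dil_diff A \<mu> B \<times> dil_diff B \<nu> C)"
  proof (rule card_inj_on_le)
    show "inj_on h (dil_diff A (\<mu> * \<nu>) C \<times> B)"
    proof (rule inj_onI)
      fix p q assume pq: "p \<in> dil_diff A (\<mu> * \<nu>) C \<times> B" "q \<in> dil_diff A (\<mu> * \<nu>) C \<times> B" "h p = h q"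
      obtain d b d' b' where e: "p = (d, b)" "q = (d', b')" by (metis surj_pair)
      have rec: "fst (h (d, b)) + \<mu> * snd (h (d, b)) = d" if "d \<in> dil_diff A (\<mu> * \<nu>) C" for d b
        using f[OF that] by (simp add: h_def algebra_simps)
      have "d = d'" using rec[of d b] rec[of d' b'] pq e by simp
      moreover from this have "b = b'" using pq e \<mu> by (simp add: h_def)
      ultimately show "p = q" using e by simp
    qed
    show "h ` (dil_diff A (\<mu> * \<nu>) C \<times> B) \<subseteq> dil_diff A \<mu> B \<times> dil_diff B \<nu> C"
      using f by (auto simp: h_def intro!: dil_diff_memI)
  qed (use fin in auto)
  then show ?thesis by (simp add: card_cartesian_product)
qed

text \<open>A - B / \<mu> is -1 / \<mu> times B - \<mu> A. This reverses relations between
  pieces.\<close>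

lemma card_dil_diff_inverse:
  assumes "\<mu> \<noteq> 0"
  shows "card (dil_diff A (inverse \<mu>) B) = card (dil_diff B \<mu> A)"
proof -
  have "dil_diff A (inverse \<mu>) B = (\<lambda>s. - inverse \<mu> * s) ` dil_diff B \<mu> A"
  proof (intro set_eqI iffI)
    fix s assume "s \<in> dil_diff A (inverse \<mu>) B"
    then obtain x y where xy: "x \<in> A" "y \<in> B" "s = real_of_int x - inverse \<mu> * real_of_int y"
      by (auto simp: dil_diff_def)
    then have "s = - inverse \<mu> * (real_of_int y - \<mu> * real_of_int x)"
      using assms by (simp add: field_simps)
    then show "s \<in> (\<lambda>s. - inverse \<mu> * s) ` dil_diff B \<mu> A"
      using dil_diff_memI[OF xy(2,1), of \<mu>] by (metis imageI)
  next
    fix s assume "s \<in> (\<lambda>s. - inverse \<mu> * s) ` dil_diff B \<mu> A"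
    then obtain x y where xy: "x \<in> B" "y \<in> A" "s = - inverse \<mu> * (real_of_int x - \<mu> * real_of_int y)"
      by (auto simp: dil_diff_def)
    then have "s = real_of_int y - inverse \<mu> * real_of_int x"
      using assms by (simp add: field_simps)
    then show "s \<in> dil_diff A (inverse \<mu>) B"
      using dil_diff_memI[OF xy(2,1), of "inverse \<mu>"] by metis
  qed
  then show ?thesis
    using assms by (simp add: card_image inj_on_def)
qed

text \<open>A sum with many representations x + \<beta> y makes U and V share, up to dilation and
  translation, a large subset.\<close>
lemma card_dil_diff_popular:
  fixes U V W :: "int set" and \<beta> :: int and n :: nat and K \<theta> :: real
  assumes fin: "finite U" "finite V" "finite W" and W: "card W \<le> n" and n: "n > 0" and \<beta>: "\<beta> \<noteq> 0"
    and K: "card (dil_diff U 1 U) \<le> K * n" "card (dil_diff V 1 V) \<le> K * n" and \<theta>: "\<theta> > 0"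
    and many: "\<theta> * n\<^sup>2 \<le> card {(x, y). x \<in> U \<and> y \<in> V \<and> x + \<beta> * y \<in> W}"
  shows "\<theta> * card (dil_diff U (- real_of_int \<beta>) V) \<le> K\<^sup>2 * n"
proof -
  define r where "r w = {y \<in> V. w - \<beta> * y \<in> U}" for w
  have finr: "finite (r w)" for w using fin by (simp add: r_def)
  have "card {(x, y). x \<in> U \<and> y \<in> V \<and> x + \<beta> * y \<in> W} \<le> card (SIGMA w:W. r w)"
  proof (rule card_inj_on_le[where f = "\<lambda>(x, y). (x + \<beta> * y, y)"])
  qed (use fin finr in \<open>auto simp: inj_on_def r_def\<close>)
  then have "card {(x, y). x \<in> U \<and> y \<in> V \<and> x + \<beta> * y \<in> W} \<le> (\<Sum>w\<in>W. card (r w))"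
    using finr fin by simp
  from of_nat_mono[OF this, where ?'a = real] have tot: "\<theta> * n\<^sup>2 \<le> (\<Sum>w\<in>W. real (card (r w)))"
    using many by simp
  have "\<exists>w\<in>W. \<theta> * n \<le> card (r w)"
  proof (rule ccontr)
    assume "\<not> ?thesis"
    then have lt: "real (card (r w)) < \<theta> * n" if "w \<in> W" for w using that by (auto simp: not_le)
    have "W \<noteq> {}" using tot n \<theta> by (auto simp: mult_le_0_iff)
    then have "(\<Sum>w\<in>W. real (card (r w))) < (\<Sum>w\<in>W. \<theta> * n)"
      using lt fin by (intro sum_strict_mono) auto
    also have "\<dots> \<le> n * (\<theta> * n)"
      using W \<theta> by (simp add: mult_right_mono)
    finally show False using tot by (simp add: power2_eq_square algebra_simps)
  qed
  then obtain w where w: "w \<in> W" "\<theta> * n \<le> card (r w)" by auto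
  \<comment> \<open>For y in \<open>r w\<close> one has \<beta> y = w - x' with x' in
    \<open>U\<close>, so the sums x + \<beta> y lie in a translate of U - U. The triangle inequality
    through \<open>r w\<close> then involves only the doublings of \<open>U\<close> and
    \<open>V\<close>.\<close>
  have "dil_diff U (- real_of_int \<beta>) (r w) \<subseteq> (\<lambda>t. t + real_of_int w) ` dil_diff U 1 U"
  proof
    fix t assume "t \<in> dil_diff U (- real_of_int \<beta>) (r w)"
    then obtain x y where xy: "x \<in> U" "w - \<beta> * y \<in> U" "t = real_of_int x + real_of_int \<beta> * real_of_int y"
      by (auto simp: dil_diff_def r_def)
    then have "t = (real_of_int x - 1 * real_of_int (w - \<beta> * y)) + real_of_int w" by simp
    then show "t \<in> (\<lambda>t. t + real_of_int w) ` dil_diff U 1 U"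
      using dil_diff_memI[OF xy(1,2), of 1] by (metis imageI)
  qed
  then have 1: "card (dil_diff U (- real_of_int \<beta>) (r w)) \<le> card (dil_diff U 1 U)"
    using fin by (intro surj_card_le) auto
  have "dil_diff (r w) 1 V \<subseteq> dil_diff V 1 V"
    by (auto simp: dil_diff_def r_def)
  then have 2: "card (dil_diff (r w) 1 V) \<le> card (dil_diff V 1 V)"
    using fin by (intro card_mono) auto
  have "card (dil_diff U (- real_of_int \<beta>) V) * card (r w)
      \<le> card (dil_diff U (- real_of_int \<beta>) (r w)) * card (dil_diff (r w) 1 V)"
    using card_dil_diff_triangle[of U "r w" V "- real_of_int \<beta>" 1] fin finr \<beta> by simp
  also have "\<dots> \<le> card (dil_diff U 1 U) * card (dil_diff V 1 V)"
    by (intro mult_mono 1 2) auto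
  finally have "card (dil_diff U (- real_of_int \<beta>) V) * card (r w)
      \<le> card (dil_diff U 1 U) * card (dil_diff V 1 V)" .
  from of_nat_mono[OF this, where ?'a = real]
  have "real (card (dil_diff U (- real_of_int \<beta>) V)) * card (r w)
      \<le> real (card (dil_diff U 1 U)) * card (dil_diff V 1 V)"
    by simp
  also have "\<dots> \<le> (K * n) * (K * n)"
    by (intro mult_mono K) (use K order_trans[OF of_nat_0_le_iff] in auto)
  finally have "real (card (dil_diff U (- real_of_int \<beta>) V)) * (\<theta> * n) \<le> (K * n) * (K * n)"
    using w(2) by (meson mult_left_mono of_nat_0_le_iff order_trans)
  then have "(\<theta> * card (dil_diff U (- real_of_int \<beta>) V)) * n \<le> (K\<^sup>2 * n) * n"
    by (simp add: power2_eq_square algebra_simps)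
  then show ?thesis using n by simp
qed

text \<open>Two elements of the set V constructed here are joined by many paths of length four in the
  bipartite graph of the pairs with \<alpha> s + y in W. Each path writes a multiple of their
  difference as an alternating sum of four elements of W, so there are few differences.\<close>
lemma balog_szemeredi_gowers:
  fixes R Y W :: "int set" and n q :: nat and \<alpha> :: int
  assumes fin: "finite R" "finite Y" "finite W"
    and le: "card R \<le> n" "card Y \<le> n" "card W \<le> n"
    and pos: "\<alpha> \<noteq> 0" "n > 0" "q > 0"
    and many: "(real n)\<^sup>2 / q \<le> card {(s, y). s \<in> R \<and> y \<in> Y \<and> \<alpha> * s + y \<in> W}"
  obtains V where "V \<subseteq> R" "n \<le> 4 * q * card V" "card (dil_diff V 1 V) \<le> 1024 * real q ^ 5 * n"
proof -
  define \<epsilon> where "\<epsilon> = 1 / real q"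
  \<comment> \<open>The factor 1/16 makes 8 n^2 (\<delta> n) equal to \<epsilon>^2 n^3 / 2, exactly
    what the averaging below can spare.\<close>
  define \<delta> where "\<delta> = \<epsilon>\<^sup>2 / 16"
  have \<epsilon>: "\<epsilon> > 0" "\<delta> > 0" using pos by (auto simp: \<epsilon>_def \<delta>_def)
  define Nb where "Nb y = {s \<in> R. \<alpha> * s + y \<in> W}" for y
  define cod where "cod s t = {y \<in> Y. s \<in> Nb y \<and> t \<in> Nb y}" for s t
  define Bad where "Bad = {(s, t) \<in> R \<times> R. card (cod s t) < \<delta> * n}"
  have finN: "finite (Nb y)" for y using fin by (simp add: Nb_def)
  have finC: "finite (cod s t)" for s t using fin by (simp add: cod_def)
  have finB: "finite Bad" unfolding Bad_def by (rule finite_subset[of _ "R \<times> R"]) (use fin in auto)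
  define bad where "bad y = {p \<in> Bad. fst p \<in> Nb y \<and> snd p \<in> Nb y}" for y
  have "{(s, y). s \<in> R \<and> y \<in> Y \<and> \<alpha> * s + y \<in> W} = prod.swap ` (SIGMA y:Y. Nb y)"
    by (auto simp: Nb_def image_iff)
  then have "card {(s, y). s \<in> R \<and> y \<in> Y \<and> \<alpha> * s + y \<in> W} = card (SIGMA y:Y. Nb y)"
    by (simp add: card_image)
  then have edges: "\<epsilon> * n\<^sup>2 \<le> (\<Sum>y\<in>Y. real (card (Nb y)))"
    using many finN fin by (simp add: \<epsilon>_def)
  have "(\<Sum>y\<in>Y. card (bad y)) = (\<Sum>p\<in>Bad. card (cod (fst p) (snd p)))"
    unfolding bad_def
    by (rule sum_multicount_gen) (use fin finB in \<open>auto simp: cod_def\<close>)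
  then have "(\<Sum>y\<in>Y. real (card (bad y))) = (\<Sum>p\<in>Bad. real (card (cod (fst p) (snd p))))"
    by (simp flip: of_nat_sum)
  also have "\<dots> \<le> (\<Sum>p\<in>Bad. \<delta> * n)"
    by (rule sum_mono) (auto simp: Bad_def)
  also have "\<dots> \<le> n\<^sup>2 * (\<delta> * n)"
  proof -
    have "card Bad \<le> card (R \<times> R)" by (rule card_mono) (use fin in \<open>auto simp: Bad_def\<close>)
    also have "\<dots> \<le> n * n" using le by (simp add: card_cartesian_product mult_mono)
    finally have "card Bad \<le> n\<^sup>2" by (simp add: power2_eq_square)
    from of_nat_mono[OF this, where ?'a = real] have "real (card Bad) \<le> n\<^sup>2" by simp
    then show ?thesis using \<epsilon> by (simp add: mult_right_mono)
  qed
  finally have bad_sum: "(\<Sum>y\<in>Y. real (card (bad y))) \<le> n\<^sup>2 * (\<delta> * n)" .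
  \<comment> \<open>Averaging selects a vertex whose neighbourhood is large and contains few bad
    pairs; 2 u v \<le> u^2 + v^2 stands in for Cauchy-Schwarz.\<close>
  have "\<exists>y\<in>Y. (\<epsilon> * n)\<^sup>2 / 2 + 8 * card (bad y) \<le> (real (card (Nb y)))\<^sup>2"
  proof (rule ccontr)
    assume neg: "\<not> ?thesis"
    have "2 * (\<epsilon> * n) * card (Nb y) < 3 / 2 * (\<epsilon> * n)\<^sup>2 + 8 * card (bad y)" if "y \<in> Y" for y
    proof -
      have "0 \<le> (\<epsilon> * n - card (Nb y))\<^sup>2" by simp
      moreover have "(real (card (Nb y)))\<^sup>2 < (\<epsilon> * n)\<^sup>2 / 2 + 8 * card (bad y)" using neg that by force
      ultimately show ?thesis by (simp add: power2_diff)
    qed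
    moreover have "Y \<noteq> {}" using edges \<epsilon> pos by (auto simp: mult_le_0_iff)
    ultimately have "(\<Sum>y\<in>Y. 2 * (\<epsilon> * n) * card (Nb y)) < (\<Sum>y\<in>Y. 3 / 2 * (\<epsilon> * n)\<^sup>2 + 8 * card (bad y))"
      using fin by (intro sum_strict_mono) auto
    also have "\<dots> = card Y * (3 / 2 * (\<epsilon> * n)\<^sup>2) + 8 * (\<Sum>y\<in>Y. real (card (bad y)))"
      by (simp add: sum.distrib sum_distrib_left)
    also have "\<dots> \<le> n * (3 / 2 * (\<epsilon> * n)\<^sup>2) + 8 * (n\<^sup>2 * (\<delta> * n))"
      by (intro add_mono mult_left_mono bad_sum mult_right_mono) (use le in auto)
    also have "\<dots> = 2 * (\<epsilon> * n) * (\<epsilon> * n\<^sup>2)"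
      by (simp add: \<delta>_def power2_eq_square algebra_simps)
    also have "\<dots> \<le> 2 * (\<epsilon> * n) * (\<Sum>y\<in>Y. real (card (Nb y)))"
      by (intro mult_left_mono edges) (use \<epsilon> in auto)
    also have "\<dots> = (\<Sum>y\<in>Y. 2 * (\<epsilon> * n) * card (Nb y))"
      by (simp add: sum_distrib_left)
    finally show False by simp
  qed
  then obtain y0 where y0: "y0 \<in> Y" "(\<epsilon> * n)\<^sup>2 / 2 + 8 * card (bad y0) \<le> (real (card (Nb y0)))\<^sup>2" by auto
  define N where "N = Nb y0"
  define c where "c = real (card N)"
  have finN0: "finite N" using finN by (simp add: N_def)
  have cge: "\<epsilon> * n / 2 \<le> c"
  proof (rule power2_le_imp_le)
    have "(\<epsilon> * n / 2)\<^sup>2 \<le> (\<epsilon> * n)\<^sup>2 / 2" by (simp add: power_divide)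
    then show "(\<epsilon> * n / 2)\<^sup>2 \<le> c\<^sup>2" using y0(2) by (simp add: c_def N_def)
  qed (simp add: c_def)
  have "0 < \<epsilon> * n / 2" using \<epsilon> pos by simp
  then have cpos: "c > 0" using cge by linarith
  define badn where "badn s = {t \<in> N. (s, t) \<in> Bad}" for s
  have finbn: "finite (badn s)" for s using finN0 by (simp add: badn_def)
  \<comment> \<open>There are at most c^2 / 8 bad pairs inside \<open>N\<close>, so at most c / 2
    elements are bad with more than a quarter of \<open>N\<close>; at least half of \<open>N\<close>
    remains.\<close>
  define V where "V = {s \<in> N. 4 * real (card (badn s)) \<le> c}"
  have VN: "V \<subseteq> N" and finV: "finite V" using finN0 by (auto simp: V_def)
  have "card (bad y0) = card (SIGMA s:N. badn s)"
    by (rule arg_cong[of _ _ card]) (auto simp: bad_def badn_def N_def)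
  then have "real (card (bad y0)) = (\<Sum>s\<in>N. real (card (badn s)))"
    using finN0 finbn by simp
  also have "\<dots> \<ge> (\<Sum>s\<in>N - V. real (card (badn s)))"
    by (rule sum_mono2) (use finN0 in auto)
  finally have "(\<Sum>s\<in>N - V. real (card (badn s))) \<le> card (bad y0)" .
  moreover have "(\<Sum>s\<in>N - V. c / 4) \<le> (\<Sum>s\<in>N - V. real (card (badn s)))"
    by (rule sum_mono) (auto simp: V_def)
  ultimately have b1: "card (N - V) * (c / 4) \<le> card (bad y0)" by simp
  have "0 \<le> (\<epsilon> * n)\<^sup>2 / 2" by simp
  then have "8 * real (card (bad y0)) \<le> c\<^sup>2" using y0(2) unfolding c_def N_def by linarith
  then have "8 * (card (N - V) * (c / 4)) \<le> c * c" using b1 unfolding power2_eq_square by linarith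
  also have "8 * (card (N - V) * (c / 4)) = 2 * real (card (N - V)) * c" by simp
  finally have "2 * real (card (N - V)) \<le> c" using cpos by (rule mult_right_le_imp_le)
  moreover have "c = card (N - V) + real (card V)"
    unfolding c_def using card_Diff_subset[OF finV VN] card_mono[OF finN0 VN] by simp
  ultimately have Vc: "c / 2 \<le> card V" by simp
  then have "\<epsilon> * n / 4 \<le> card V" using cge by simp
  then have "real n \<le> 4 * q * card V" using pos by (simp add: \<epsilon>_def field_simps)
  then have "real n \<le> real (4 * q * card V)" by simp
  then have V_large: "n \<le> 4 * q * card V" by (rule of_nat_le_iff[THEN iffD1])
  have Bad_sym: "(s, t) \<in> Bad \<longleftrightarrow> (t, s) \<in> Bad" for s t
    by (auto simp: Bad_def cod_def conj_commute)
  define alt where "alt = (\<lambda>(w1, w2, w3, w4). w1 - w2 + w3 - w4 :: int)"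
  define Q where "Q d = {p \<in> W \<times> W \<times> W \<times> W. alt p = \<alpha> * d}" for d
  define D where "D = (\<lambda>(s, t). s - t) ` (V \<times> V)"
  have finQ: "finite (Q d)" for d unfolding Q_def using fin by simp
  have "c / 2 * (\<delta> * n)\<^sup>2 \<le> card (Q d)" if d: "d \<in> D" for d
  proof -
    obtain s t where st: "s \<in> V" "t \<in> V" "d = s - t" using d by (auto simp: D_def)
    \<comment> \<open>These are the centres v of paths s - y - v - y' - t. Each of s and t excludes
      at most a quarter of \<open>N\<close>, and every remaining v allows at least (\<delta> n)^2
      choices of y and y'.\<close>
    define M where "M = {v \<in> N. (s, v) \<notin> Bad \<and> (v, t) \<notin> Bad}"
    have "N - M \<subseteq> badn s \<union> badn t" using Bad_sym by (auto simp: M_def badn_def)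
    then have "card (N - M) \<le> card (badn s) + card (badn t)"
      using finbn by (meson card_Un_le card_mono finite_UnI order_trans)
    then have "2 * real (card (N - M)) \<le> c" using st by (simp add: V_def)
    moreover have M: "M \<subseteq> N" "finite M" using finN0 by (auto simp: M_def)
    then have "c = card (N - M) + real (card M)"
      unfolding c_def using card_Diff_subset[OF M(2,1)] card_mono[OF finN0 M(1)] by simp
    ultimately have "c / 2 \<le> card M" by simp
    then have "c / 2 * (\<delta> * n)\<^sup>2 \<le> card M * (\<delta> * n)\<^sup>2"
      by (rule mult_right_mono) simp
    also have "\<dots> = (\<Sum>v\<in>M. (\<delta> * n)\<^sup>2)" by simp
    also have "\<dots> \<le> (\<Sum>v\<in>M. real (card (cod s v \<times> cod v t)))"
    proof (rule sum_mono)
      fix v assume v: "v \<in> M"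
      then have "v \<in> R" "s \<in> R" "t \<in> R" using st VN by (auto simp: M_def N_def Nb_def)
      then have "\<delta> * n \<le> card (cod s v)" "\<delta> * n \<le> card (cod v t)"
        using v by (auto simp: M_def Bad_def)
      then show "(\<delta> * n)\<^sup>2 \<le> real (card (cod s v \<times> cod v t))"
        unfolding power2_eq_square card_cartesian_product of_nat_mult
        by (intro mult_mono) (use \<epsilon> in auto)
    qed
    also have "\<dots> = card (SIGMA v:M. cod s v \<times> cod v t)"
      using \<open>finite M\<close> finC by simp
    also have "\<dots> \<le> card (Q d)"
    proof -
      have "card (SIGMA v:M. cod s v \<times> cod v t) \<le> card (Q d)"
      proof (rule card_inj_on_le[OF _ _ finQ])
        show "inj_on (\<lambda>(v, y, y'). (\<alpha> * s + y, \<alpha> * v + y, \<alpha> * v + y', \<alpha> * t + y'))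
            (SIGMA v:M. cod s v \<times> cod v t)"
          using pos by (auto simp: inj_on_def)
        show "(\<lambda>(v, y, y'). (\<alpha> * s + y, \<alpha> * v + y, \<alpha> * v + y', \<alpha> * t + y')) `
            (SIGMA v:M. cod s v \<times> cod v t) \<subseteq> Q d"
          by (auto simp: Q_def alt_def cod_def Nb_def st algebra_simps)
      qed
      then show ?thesis by simp
    qed
    finally show ?thesis .
  qed
  then have "(\<Sum>d\<in>D. c / 2 * (\<delta> * n)\<^sup>2) \<le> (\<Sum>d\<in>D. real (card (Q d)))"
    by (rule sum_mono)
  also have "\<dots> = real (card (\<Union>d\<in>D. Q d))"
  proof -
    have "finite D" using finV by (simp add: D_def)
    then have "card (\<Union>d\<in>D. Q d) = (\<Sum>d\<in>D. card (Q d))"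
      using finQ pos by (intro card_UN_disjoint) (auto simp: Q_def)
    then show ?thesis by simp
  qed
  also have "\<dots> \<le> real n ^ 4"
  proof -
    have "card (\<Union>d\<in>D. Q d) \<le> card (W \<times> W \<times> W \<times> W)"
      by (rule card_mono) (use fin in \<open>auto simp: Q_def\<close>)
    also have "\<dots> = card W ^ 4" by (simp add: card_cartesian_product eval_nat_numeral)
    also have "\<dots> \<le> n ^ 4" using le by (intro power_mono) auto
    finally have "card (\<Union>d\<in>D. Q d) \<le> n ^ 4" .
    from of_nat_mono[OF this, where ?'a = real] show ?thesis by simp
  qed
  finally have D1: "card D * (c / 2 * (\<delta> * n)\<^sup>2) \<le> real n ^ 4" by simp
  \<comment> \<open>Inserting c \<ge> \<epsilon> n / 2 gives \<open>card D\<close> \<le> 4 n /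
    (\<epsilon> \<delta>^2), which is 1024 q^5 n.\<close>
  have "card D * ((\<epsilon> * n / 4) * (\<delta> * n)\<^sup>2) \<le> card D * (c / 2 * (\<delta> * n)\<^sup>2)"
    by (intro mult_left_mono mult_right_mono) (use cge in auto)
  then have "card D * ((\<epsilon> * n / 4) * (\<delta> * n)\<^sup>2) \<le> real n ^ 4" using D1 by linarith
  then have "real n ^ 3 * real (card D) \<le> real n ^ 3 * (1024 * real q ^ 5 * n)"
    using pos by (simp add: \<epsilon>_def \<delta>_def field_simps eval_nat_numeral)
  then have "real (card D) \<le> 1024 * real q ^ 5 * n" using pos by simp
  moreover have "dil_diff V 1 V = real_of_int ` D"
    by (auto simp: dil_diff_def D_def image_image split_beta intro!: image_cong)
  then have "card (dil_diff V 1 V) = card D" by (simp add: card_image inj_on_def)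
  moreover have "V \<subseteq> R" using VN by (auto simp: N_def Nb_def)
  ultimately show ?thesis using that V_large by simp
qed

section \<open>Levels\<close>

text \<open>Potentials on a labelled graph: fix a root in every component and read the potential of a
  vertex off a shortest path from the root, which has fewer than card P edges.\<close>
lemma potential_exists:
  fixes E :: "'v \<Rightarrow> 'v \<Rightarrow> int \<Rightarrow> bool" and P :: "'v set"
  defines "Step \<equiv> {((u, e), (v, f)). u \<in> P \<and> v \<in> P \<and> E u v (f - e)}"
  assumes fin: "finite P"
    and sym: "\<And>u v d. E u v d \<Longrightarrow> E v u (- d)"
    and closed: "\<And>u e k. u \<in> P \<Longrightarrow> k < 2 * card P \<Longrightarrow> ((u, 0), (u, e)) \<in> Step ^^ k \<Longrightarrow> e = 0"
  shows "\<exists>lev. \<forall>u\<in>P. \<forall>v\<in>P. \<forall>d. E u v d \<longrightarrow> lev v = lev u + d"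
proof -
  define G where "G = {(u, v). u \<in> P \<and> v \<in> P \<and> (\<exists>d. E u v d)}"
  have shift: "((u, e + t), (v, f + t)) \<in> Step ^^ k" if "((u, e), (v, f)) \<in> Step ^^ k" for u e v f t k
    using that
  proof (induction k arbitrary: v f)
    case (Suc k)
    then obtain w g where w: "((u, e), (w, g)) \<in> Step ^^ k" "((w, g), (v, f)) \<in> Step" by auto
    have "((w, g + t), (v, f + t)) \<in> Step" using w(2) by (simp add: Step_def)
    with Suc.IH[OF w(1)] show ?case by auto
  qed simp
  have Step_sym: "(p, q) \<in> Step \<Longrightarrow> (q, p) \<in> Step" for p q
    using sym by (auto simp: Step_def) (metis minus_diff_eq)
  have rev: "(q, p) \<in> Step ^^ k" if "(p, q) \<in> Step ^^ k" for p q k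
    using that
  proof (induction k arbitrary: q)
    case (Suc k)
    then obtain r where "(p, r) \<in> Step ^^ k" "(r, q) \<in> Step" by auto
    then have "(q, r) \<in> Step" "(r, p) \<in> Step ^^ k" using Suc.IH Step_sym by auto
    then show ?case by (rule relpow_Suc_I2)
  qed simp
  have lift: "\<exists>e. ((u, 0), (v, e)) \<in> Step ^^ k" if "(u, v) \<in> G ^^ k" for u v k
    using that
  proof (induction k arbitrary: v)
    case 0 then show ?case by auto
  next
    case (Suc k)
    then obtain w where "(u, w) \<in> G ^^ k" and w: "(w, v) \<in> G" by auto
    then obtain e where "((u, 0), (w, e)) \<in> Step ^^ k" using Suc.IH by blast
    moreover obtain d where "E w v d" "w \<in> P" "v \<in> P" using w by (auto simp: G_def)
    then have "((w, e), (v, e + d)) \<in> Step" by (simp add: Step_def)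
    ultimately show ?case by auto
  qed
  have short: "\<exists>k<card P. (u, v) \<in> G ^^ k" if uv: "(u, v) \<in> G\<^sup>*" "u \<in> P" for u v
  proof -
    define k where "k = (LEAST k. (u, v) \<in> G ^^ k)"
    obtain k0 where "(u, v) \<in> G ^^ k0" using uv rtrancl_imp_relpow by metis
    then have k: "(u, v) \<in> G ^^ k" unfolding k_def by (rule LeastI)
    then obtain f where f: "f 0 = u" "f k = v" "\<And>i. i < k \<Longrightarrow> (f i, f (Suc i)) \<in> G"
      unfolding relpow_fun_conv by auto
    have fP: "f i \<in> P" if "i \<le> k" for i
      using that f(3)[of "i - 1"] f(1) uv(2) by (cases i) (auto simp: G_def)
    have path: "(f i, f j) \<in> G ^^ (j - i)" if "i \<le> j" "j \<le> k" for i j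
      unfolding relpow_fun_conv
      by (rule exI[of _ "\<lambda>t. f (i + t)"]) (use that f(3) in auto)
    have "f i \<noteq> f j" if "i < j" "j \<le> k" for i j
    proof
      assume "f i = f j"
      then have "(u, f j) \<in> G ^^ i" "(f j, v) \<in> G ^^ (k - j)"
        using path[of 0 i] path[of j k] that f(1,2) by simp_all
      then have "(u, v) \<in> G ^^ (i + (k - j))"
        by (metis relcompI relpow_add)
      then have "k \<le> i + (k - j)" unfolding k_def by (rule Least_le)
      then show False using that by simp
    qed
    then have "inj_on f {..k}" by (intro inj_onI) (metis atMost_iff linorder_neqE_nat)
    then have "card {..k} \<le> card P" by (rule card_inj_on_le) (use fP fin in auto)
    then show ?thesis using k by (intro exI[of _ k]) auto
  qed
  have symG: "sym (G\<^sup>*)" by (rule sym_rtrancl) (use sym in \<open>auto simp: G_def sym_def\<close>)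
  \<comment> \<open>Vertices of one component reach the same vertices, so the choice operator sees
    equal predicates and picks the same root.\<close>
  define root where "root v = (SOME u. (v, u) \<in> G\<^sup>*)" for v
  have root: "(v, root v) \<in> G\<^sup>*" for v unfolding root_def by (rule someI[of _ v]) simp
  have root_eq: "root u = root v" if "(u, v) \<in> G" for u v
  proof -
    have "(u, w) \<in> G\<^sup>* \<longleftrightarrow> (v, w) \<in> G\<^sup>*" for w
      using that symG by (meson r_into_rtrancl rtrancl_trans symE)
    then show ?thesis by (simp add: root_def)
  qed
  have rootP: "root v \<in> P" if "v \<in> P" for v
    using root[of v] that by (induction rule: rtrancl_induct) (auto simp: G_def)
  have "\<exists>e k. k < card P \<and> ((root v, 0), (v, e)) \<in> Step ^^ k" if "v \<in> P" for v
    using short[of "root v" v] lift rootP[OF that] symG root[of v] by (meson symE)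
  then obtain lev len where lev: "\<And>v. v \<in> P \<Longrightarrow> len v < card P"
    "\<And>v. v \<in> P \<Longrightarrow> ((root v, 0), (v, lev v)) \<in> Step ^^ len v" by metis
  \<comment> \<open>Root to \<open>u\<close>, the edge to \<open>v\<close> and the reversed path to
    the root form a closed walk of at most 2 (\<open>card P\<close> - 1) + 1 edges, which is why
    \<open>closed\<close> speaks of lengths below 2 * \<open>card P\<close>.\<close>
  have "lev v = lev u + d" if uv: "u \<in> P" "v \<in> P" "E u v d" for u v d
  proof -
    have "root u = root v" using uv by (intro root_eq) (auto simp: G_def)
    moreover have "((u, lev u), (v, lev u + d)) \<in> Step" using uv by (simp add: Step_def)
    then have "((root u, 0), (v, lev u + d)) \<in> Step ^^ Suc (len u)" using lev(2)[OF uv(1)] by auto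
    moreover have "((v, lev v), (root v, 0)) \<in> Step ^^ len v" by (rule rev[OF lev(2)[OF uv(2)]])
    from shift[OF this, of "lev u + d - lev v"]
    have "((v, lev u + d), (root v, lev u + d - lev v)) \<in> Step ^^ len v" by simp
    ultimately have "((root u, 0), (root u, lev u + d - lev v)) \<in> Step ^^ (Suc (len u) + len v)"
      by (metis relcompI relpow_add)
    then have "lev u + d - lev v = 0"
      by (rule closed[rotated 2]) (use lev(1)[OF uv(1)] lev(1)[OF uv(2)] rootP uv in auto)
    then show ?thesis by simp
  qed
  then show ?thesis by blast
qed

text \<open>A disjoint family of pieces with the most members exists because every piece fills at
  least a 1 / (4 q) part of \<open>S\<close>. If the remainder met many solutions in one coordinate,
  \<open>balog_szemeredi_gowers\<close> would find a further piece in it; so each of the three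
  coordinates costs at most n^2 / q.\<close>

lemma structured_decomposition:
  fixes S :: "int set" and a :: int and q :: nat
  assumes fin: "finite S" and ne: "S \<noteq> {}" and a: "a \<noteq> 0" and q: "q > 0"
  obtains P where "finite P"
    "\<And>V. V \<in> P \<Longrightarrow> V \<subseteq> S" "\<And>V. V \<in> P \<Longrightarrow> card S \<le> 4 * q * card V"
    "\<And>V. V \<in> P \<Longrightarrow> card (dil_diff V 1 V) \<le> 1024 * real q ^ 5 * card S"
    "pairwise disjnt P" "card P \<le> 4 * q"
    "card {(x, y, z) \<in> solutions a S. x \<notin> \<Union>P \<or> y \<notin> \<Union>P \<or> z \<notin> \<Union>P} \<le> 3 * (real (card S))\<^sup>2 / q"
proof -
  define n where "n = card S"
  have n: "n > 0" using fin ne by (auto simp: n_def)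
  define piece where "piece V \<longleftrightarrow> V \<subseteq> S \<and> n \<le> 4 * q * card V \<and>
    card (dil_diff V 1 V) \<le> 1024 * real q ^ 5 * n" for V
  define fam where "fam P \<longleftrightarrow> pairwise disjnt P \<and> (\<forall>V\<in>P. piece V)" for P
  have finP: "finite P" if "fam P" for P
    by (rule finite_subset[of _ "Pow S"]) (use that fin in \<open>auto simp: fam_def piece_def\<close>)
  have cardP: "card P \<le> 4 * q" if P: "fam P" for P
  proof -
    have "(\<Sum>V\<in>P. card V) = card (\<Union>P)"
      using P fin finite_subset
      by (intro card_Union_disjoint[symmetric]) (auto simp: fam_def piece_def)
    also have "\<dots> \<le> n" unfolding n_def using P fin
      by (intro card_mono) (auto simp: fam_def piece_def)
    finally have "(\<Sum>V\<in>P. 4 * q * card V) \<le> 4 * q * n" by (simp flip: sum_distrib_left)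
    moreover have "(\<Sum>V\<in>P. n) \<le> (\<Sum>V\<in>P. 4 * q * card V)"
      by (rule sum_mono) (use P in \<open>auto simp: fam_def piece_def\<close>)
    ultimately have "(\<Sum>V\<in>P. n) \<le> 4 * q * n" by (rule order_trans[rotated])
    then show ?thesis using n by simp
  qed
  have "fam {}" by (simp add: fam_def)
  moreover have "\<forall>P. fam P \<longrightarrow> card P < 4 * q + 1" using cardP by (auto simp: less_Suc_eq_le)
  ultimately obtain P where P: "fam P" and max: "\<And>P'. fam P' \<Longrightarrow> card P' \<le> card P"
    using ex_has_greatest_nat[of fam "{}" card "4 * q + 1"] by metis
  define R where "R = S - \<Union>P"
  have few: "card {(s, y). s \<in> R \<and> y \<in> S \<and> \<alpha> * s + y \<in> W} < (real n)\<^sup>2 / q"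
    if \<alpha>: "\<alpha> \<noteq> 0" and W: "finite W" "card W \<le> n" for \<alpha> :: int and W
  proof (rule ccontr)
    assume "\<not> ?thesis"
    then have many: "(real n)\<^sup>2 / q \<le> card {(s, y). s \<in> R \<and> y \<in> S \<and> \<alpha> * s + y \<in> W}" by simp
    have R: "finite R" "card R \<le> n" using fin by (auto simp: R_def n_def intro: card_mono)
    obtain V where V: "V \<subseteq> R" "n \<le> 4 * q * card V" "card (dil_diff V 1 V) \<le> 1024 * real q ^ 5 * n"
      using balog_szemeredi_gowers[OF R(1) fin W(1) R(2) _ W(2) \<alpha> n q many] by (auto simp: n_def)
    have "V \<noteq> {}" using V(2) n by auto
    then have "V \<notin> P" using V(1) by (auto simp: R_def)
    have "piece V" using V by (auto simp: piece_def R_def)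
    moreover have "disjnt V U" if "U \<in> P" for U using V(1) that by (auto simp: R_def disjnt_def)
    ultimately have "fam (insert V P)"
      using P by (auto simp: fam_def pairwise_insert disjnt_sym)
    from max[OF this] show False using \<open>V \<notin> P\<close> finP[OF P] by simp
  qed
  \<comment> \<open>A solution with x in \<open>R\<close> gives the pair (x, y) with sum in -a S,
    and likewise with x and y exchanged; one with z in \<open>R\<close> gives (z, x) with a z + x in
    -S.\<close>
  define W1 where "W1 = (\<lambda>z. - (a * z)) ` S"
  define W2 where "W2 = uminus ` S"
  have W: "finite W1" "card W1 \<le> n" "finite W2" "card W2 \<le> n"
    using fin by (auto simp: W1_def W2_def n_def card_image_le)
  define B1 where "B1 = {(s, y). s \<in> R \<and> y \<in> S \<and> 1 * s + y \<in> W1}"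
  define B2 where "B2 = {(s, y). s \<in> R \<and> y \<in> S \<and> a * s + y \<in> W2}"
  have B: "finite B1" "finite B2"
    by (rule finite_subset[of _ "R \<times> S"]; use fin in \<open>auto simp: B1_def B2_def R_def\<close>)+
  have B_few: "card B1 < (real n)\<^sup>2 / q" "card B2 < (real n)\<^sup>2 / q"
    unfolding B1_def B2_def by (rule few; use W a in simp)+
  define X where "X i = {p \<in> solutions a S. case p of (x, y, z) \<Rightarrow> (if i = (0::nat) then x else if i = 1 then y else z) \<in> R}" for i
  have "{(x, y, z) \<in> solutions a S. x \<notin> \<Union>P \<or> y \<notin> \<Union>P \<or> z \<notin> \<Union>P} \<subseteq> X 0 \<union> X 1 \<union> X 2"
    by (auto simp: X_def solutions_def R_def)
  moreover have finX: "finite (X i)" for i unfolding X_def using fin by simp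
  ultimately have "card {(x, y, z) \<in> solutions a S. x \<notin> \<Union>P \<or> y \<notin> \<Union>P \<or> z \<notin> \<Union>P} \<le> card (X 0 \<union> X 1 \<union> X 2)"
    by (intro card_mono) auto
  also have "\<dots> \<le> card (X 0) + card (X 1) + card (X 2)"
    using card_Un_le[of "X 0 \<union> X 1" "X 2"] card_Un_le[of "X 0" "X 1"] by linarith
  also have "card (X 0) \<le> card B1"
  proof (rule card_inj_on_le[OF _ _ B(1)])
    show "inj_on (\<lambda>(x, y, z). (x, y)) (X 0)"
      by (rule inj_on_subset[OF inj_on_solutions[OF a, of S]]) (auto simp: X_def)
    show "(\<lambda>(x, y, z). (x, y)) ` X 0 \<subseteq> B1"
      by (auto simp: X_def B1_def solutions_def W1_def image_iff eq_neg_iff_add_eq_0)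
  qed
  also have "card (X 1) \<le> card B1"
  proof (rule card_inj_on_le[OF _ _ B(1)])
    have "inj_on (prod.swap \<circ> (\<lambda>(x, y, z). (x, y))) (X 1)"
      by (intro comp_inj_on inj_on_subset[OF inj_on_solutions[OF a, of S]]) (auto simp: X_def)
    then show "inj_on (\<lambda>(x, y, z). (y, x)) (X 1)"
      by (rule inj_on_cong[THEN iffD1, rotated]) auto
    show "(\<lambda>(x, y, z). (y, x)) ` X 1 \<subseteq> B1"
      by (auto simp: X_def B1_def solutions_def W1_def image_iff eq_neg_iff_add_eq_0 add.commute)
  qed
  also have "card (X 2) \<le> card B2"
  proof (rule card_inj_on_le[OF _ _ B(2)])
    show "inj_on (\<lambda>(x, y, z). (z, x)) (X 2)"
      by (auto simp: inj_on_def X_def solutions_def)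
    show "(\<lambda>(x, y, z). (z, x)) ` X 2 \<subseteq> B2"
      by (auto simp: X_def B2_def solutions_def W2_def image_iff eq_neg_iff_add_eq_0 ac_simps)
  qed
  finally have "card {(x, y, z) \<in> solutions a S. x \<notin> \<Union>P \<or> y \<notin> \<Union>P \<or> z \<notin> \<Union>P}
      \<le> card B1 + card B1 + card B2"
    by simp
  from of_nat_mono[OF this, where ?'a = real] have "card {(x, y, z) \<in> solutions a S. x \<notin> \<Union>P \<or> y \<notin> \<Union>P \<or> z \<notin> \<Union>P} \<le> 3 * (real n)\<^sup>2 / q"
    using B_few by simp
  then show ?thesis
    using that[of P] P finP[OF P] cardP[OF P] by (auto simp: fam_def piece_def n_def)
qed

lemma dil_diff_eq_dilate_sum: "dil_diff A (- real_of_int c) B = real_of_int ` dilate_sum A c B"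
  by (force simp: dil_diff_def dilate_sum_def image_image)

text \<open>A closed walk with nonzero net exponent makes some piece V commensurable with a proper
  dilate of itself, which the lower bound for dilate sums forbids.\<close>
lemma no_unbalanced_closed_walk:
  fixes a :: int and P :: "int set set" and n q :: nat and K :: real
  defines "K \<equiv> 1024 * real q ^ 5"
  defines "E \<equiv> (\<lambda>U V d. \<bar>d\<bar> \<le> 1 \<and> card (dil_diff U (- (real_of_int a powi - d)) V) \<le> 2 ^ 25 * real q ^ 13 * n)"
  defines "Step \<equiv> {((U, e), (V, f)). U \<in> P \<and> V \<in> P \<and> E U V (f - e)}"
  assumes a: "a \<ge> 2" and q: "q > 0" and n: "n > 0"
    and growth: "(2 ^ 27 * real q ^ 14) ^ (8 * q) \<le> a"
    and P: "\<And>V. V \<in> P \<Longrightarrow> finite V" "\<And>V. V \<in> P \<Longrightarrow> n \<le> 4 * q * card V"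
      "\<And>V. V \<in> P \<Longrightarrow> card (dil_diff V 1 V) \<le> K * n" "card P \<le> 4 * q"
    and dilates: "\<And>V c s. V \<in> P \<Longrightarrow> 1 \<le> s \<Longrightarrow> s \<le> 8 * q \<Longrightarrow> \<bar>c\<bar> = a ^ s \<Longrightarrow>
      \<bar>c\<bar> * card V \<le> card (dilate_sum V c V)"
    and walk: "U \<in> P" "k < 2 * card P" "((U, 0), (U, e)) \<in> Step ^^ k"
  shows "e = 0"
proof (rule ccontr)
  assume e: "e \<noteq> 0"
  define L where "L = 2 ^ 27 * real q ^ 14"
  have L: "L = 4 * q * (2 ^ 25 * real q ^ 13)" by (simp add: L_def eval_nat_numeral)
  have a0: "real_of_int a \<noteq> 0" using a by simp
  \<comment> \<open>Composing along the walk keeps the factor a power of \<open>a\<close> up to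
    sign, at the price of \<open>L\<close> per edge; the empty walk is the doubling bound for
    \<open>U\<close>. The sign alternates, so only its membership in {1, -1} is carried
    along.\<close>
  have "V \<in> P \<and> \<bar>f - g\<bar> \<le> int k \<and> (\<exists>\<sigma>\<in>{1, -1}. card (dil_diff U (\<sigma> * real_of_int a powi (g - f)) V) \<le> K * L ^ k * n)"
    if "((U, g), (V, f)) \<in> Step ^^ k" for k V f g
    using that
  proof (induction k arbitrary: V f)
    case 0
    then show ?case using P(3) walk(1) by auto
  next
    case (Suc k)
    then obtain M h where M: "((U, g), (M, h)) \<in> Step ^^ k" "((M, h), (V, f)) \<in> Step" by auto
    obtain \<sigma> where \<sigma>: "\<sigma> \<in> {1, -1}" "card (dil_diff U (\<sigma> * real_of_int a powi (g - h)) M) \<le> K * L ^ k * n"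
      and MP: "M \<in> P" "\<bar>h - g\<bar> \<le> int k"
      using Suc.IH[OF M(1)] by blast
    have V: "V \<in> P" "\<bar>f - h\<bar> \<le> 1"
      "card (dil_diff M (- (real_of_int a powi - (f - h))) V) \<le> 2 ^ 25 * real q ^ 13 * n"
      using M(2) by (auto simp: Step_def E_def)
    have "(\<sigma> * real_of_int a powi (g - h)) * (- (real_of_int a powi - (f - h)))
        = - \<sigma> * (real_of_int a powi ((g - h) + - (f - h)))"
      using power_int_add[of "real_of_int a" "g - h" "- (f - h)"] a0 by simp
    also have "(g - h) + - (f - h) = g - f" by simp
    finally have prod: "(\<sigma> * real_of_int a powi (g - h)) * (- (real_of_int a powi - (f - h)))
        = - \<sigma> * real_of_int a powi (g - f)" .
    have "card (dil_diff U (- \<sigma> * real_of_int a powi (g - f)) V) * card M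
      \<le> card (dil_diff U (\<sigma> * real_of_int a powi (g - h)) M)
        * card (dil_diff M (- (real_of_int a powi - (f - h))) V)"
      unfolding prod[symmetric]
      by (rule card_dil_diff_triangle) (use P(1) walk(1) MP V \<sigma> a0 in auto)
    from of_nat_mono[OF this, where ?'a = real]
    have "real (card (dil_diff U (- \<sigma> * real_of_int a powi (g - f)) V)) * card M
      \<le> real (card (dil_diff U (\<sigma> * real_of_int a powi (g - h)) M))
        * card (dil_diff M (- (real_of_int a powi - (f - h))) V)"
      by simp
    also have "\<dots> \<le> (K * L ^ k * n) * (2 ^ 25 * real q ^ 13 * n)"
      by (intro mult_mono \<sigma> V) (auto simp: K_def L_def)
    finally have *: "real (card (dil_diff U (- \<sigma> * real_of_int a powi (g - f)) V)) * card M
      \<le> (K * L ^ k * n) * (2 ^ 25 * real q ^ 13 * n)" .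
    define c where "c = real (card (dil_diff U (- \<sigma> * real_of_int a powi (g - f)) V))"
    have "real n \<le> 4 * q * real (card M)" using of_nat_mono[OF P(2)[OF MP(1)], where ?'a = real] by simp
    then have "c * n \<le> c * (4 * q * real (card M))" by (intro mult_left_mono) (auto simp: c_def)
    also have "\<dots> = 4 * q * (c * card M)" by simp
    also have "\<dots> \<le> 4 * q * ((K * L ^ k * n) * (2 ^ 25 * real q ^ 13 * n))"
      using * by (intro mult_left_mono) (auto simp: c_def)
    also have "\<dots> = (K * L ^ Suc k * n) * n"
      by (simp add: L algebra_simps)
    finally have "c \<le> K * L ^ Suc k * n" using n by simp
    moreover have "- \<sigma> \<in> {1, -1}" using \<sigma>(1) by auto
    moreover have "\<bar>f - g\<bar> \<le> int (Suc k)" using MP V by simp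
    ultimately show ?case using V(1) unfolding c_def by blast
  qed
  from this[OF walk(3), unfolded diff_0 diff_0_right]
  obtain \<sigma> :: real where \<sigma>: "\<sigma> \<in> {1, -1}" and ek: "\<bar>e\<bar> \<le> int k"
    and small: "card (dil_diff U (\<sigma> * real_of_int a powi - e) U) \<le> K * L ^ k * n"
    by blast
  \<comment> \<open>A positive e gives the factor a^(-s), which \<open>card_dil_diff_inverse\<close>
    turns into a^s. The relation then concerns an integer dilate \<open>c\<close> with |c| = a^s, to
    which \<open>dilates\<close> applies.\<close>
  define s where "s = nat \<bar>e\<bar>"
  have s: "1 \<le> s" "s \<le> 8 * q" using e ek walk(2) P(4) by (auto simp: s_def)
  define c where "c = (if \<sigma> = 1 then - (a ^ s) else a ^ s)"
  have ca: "\<bar>c\<bar> = a ^ s" using a by (simp add: c_def)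
  have c\<sigma>: "- real_of_int c = \<sigma> * real_of_int a ^ s" using \<sigma> by (auto simp: c_def)
  have "card (dil_diff U (- real_of_int c) U) = card (dil_diff U (\<sigma> * real_of_int a powi - e) U)"
  proof (cases "e > 0")
    case True
    then have "e = int s" by (simp add: s_def)
    then have "\<sigma> * real_of_int a powi - e = inverse (- real_of_int c)"
      using \<sigma> unfolding c\<sigma> by (auto simp: power_int_minus)
    moreover have "c \<noteq> 0" using a by (simp add: c_def)
    ultimately show ?thesis using card_dil_diff_inverse[of "- real_of_int c" U U] by simp
  next
    case False
    then have "- e = int s" by (simp add: s_def)
    then show ?thesis by (simp add: c\<sigma>)
  qed
  then have "card (dilate_sum U c U) \<le> K * L ^ k * n"
    using small unfolding dil_diff_eq_dilate_sum by (simp add: card_image inj_on_def)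
  moreover have "a * card U \<le> card (dilate_sum U c U)"
  proof -
    have "a ^ 1 \<le> a ^ s" using a s by (intro power_increasing) auto
    then have "a * card U \<le> \<bar>c\<bar> * card U" unfolding ca by (intro mult_right_mono) auto
    also have "\<dots> \<le> card (dilate_sum U c U)" by (rule dilates[OF walk(1) s ca])
    finally show ?thesis .
  qed
  then have "real_of_int a * card U \<le> card (dilate_sum U c U)"
    by (metis of_int_le_iff of_int_mult of_int_of_nat_eq)
  moreover have nU: "real n \<le> 4 * q * card U"
    using of_nat_mono[OF P(2)[OF walk(1)], where ?'a = real] by simp
  have "K * L ^ k * n \<le> K * L ^ k * (4 * q * card U)"
    by (intro mult_left_mono nU) (auto simp: K_def L_def)
  ultimately have "real_of_int a * card U \<le> (4 * q * K * L ^ k) * card U" by (simp add: mult_ac)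
  moreover have "card U > 0" using P(2)[OF walk(1)] n by (cases "card U") auto
  ultimately have "a \<le> 4 * q * K * L ^ k" by simp
  \<comment> \<open>As 4 q K = 2^12 q^6 is strictly below \<open>L\<close>, the initial cost is less
    than that of one more edge; k + 1 \<le> 8 q then contradicts \<open>growth\<close>.\<close>
  also have "\<dots> < L * L ^ k"
  proof (rule mult_strict_right_mono)
    have "real q ^ 6 \<le> real q ^ 14" using q by (intro power_increasing) auto
    moreover have "0 < real q ^ 14" using q by simp
    ultimately have "4096 * real q ^ 6 < 134217728 * real q ^ 14" by linarith
    moreover have "4 * q * K = 4096 * real q ^ 6"
      by (simp add: K_def eval_nat_numeral)
    ultimately show "4 * q * K < L" by (simp add: L_def)
  qed (use q in \<open>simp add: L_def\<close>)
  also have "\<dots> = L ^ Suc k" by simp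
  also have "\<dots> \<le> L ^ (8 * q)"
  proof (rule power_increasing)
    show "Suc k \<le> 8 * q" using walk(2) P(4) by simp
    have "1 \<le> real q ^ 14" using q by simp
    then show "1 \<le> L" by (simp add: L_def)
  qed
  finally show False using growth by (simp add: L_def)
qed

text \<open>A union bound that prices the pairs of pieces carrying too few solutions for
  \<open>card_dil_diff_popular\<close>.\<close>

lemma card_UN_sparse_le:
  fixes N :: "'a \<times> 'a \<Rightarrow> 'b set" and t :: real
  assumes "finite P" "0 \<le> t"
  shows "card (\<Union>p\<in>{p \<in> P \<times> P. card (N p) < t}. N p) \<le> (real (card P))\<^sup>2 * t"
proof -
  have fin: "finite {p \<in> P \<times> P. card (N p) < t}" using assms by simp
  have "card (\<Union>p\<in>{p \<in> P \<times> P. card (N p) < t}. N p) \<le> (\<Sum>p\<in>{p \<in> P \<times> P. card (N p) < t}. card (N p))"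
    by (rule card_UN_le[OF fin])
  from of_nat_mono[OF this, where ?'a = real]
  have "card (\<Union>p\<in>{p \<in> P \<times> P. card (N p) < t}. N p) \<le> (\<Sum>p\<in>{p \<in> P \<times> P. card (N p) < t}. real (card (N p)))"
    by simp
  also have "\<dots> \<le> (\<Sum>p\<in>{p \<in> P \<times> P. card (N p) < t}. t)"
    by (rule sum_mono) auto
  also have "\<dots> \<le> (\<Sum>p\<in>P \<times> P. t)"
    by (rule sum_mono2) (use assms in auto)
  also have "\<dots> = (real (card P))\<^sup>2 * t"
    by (simp add: card_cartesian_product power2_eq_square)
  finally show ?thesis .
qed

text \<open>Pieces are vertices of a graph: a small U + V asks for equal levels, a small U + a V
  puts V one level below U. \<open>no_unbalanced_closed_walk\<close> provides a potential, and a
  point inherits the level of a piece containing it. The pairs (x, y) and (x, z) suffice, y being on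
  the level of x. Exceptions are 3 n^2 / q solutions leaving the pieces and n^2 / (2 q) for each
  kind of pair.\<close>

lemma almost_graded:
  fixes S :: "int set" and a :: int and q :: nat
  assumes fin: "finite S" and ne: "S \<noteq> {}" and a: "a \<ge> 2" and q: "q > 0"
    and growth: "(2 ^ 27 * real q ^ 14) ^ (8 * q) \<le> a"
    and dilates: "\<And>V c s. finite V \<Longrightarrow> card S \<le> 4 * q * card V \<Longrightarrow> 1 \<le> s \<Longrightarrow> s \<le> 8 * q \<Longrightarrow> \<bar>c\<bar> = a ^ s \<Longrightarrow>
      \<bar>c\<bar> * card V \<le> card (dilate_sum V c V)"
  obtains lev :: "int \<Rightarrow> int" where
    "card {(x, y, z) \<in> solutions a S. \<not> (lev x = lev z + 1 \<and> lev y = lev z + 1)} \<le> 4 * (real (card S))\<^sup>2 / q"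
proof -
  define n where "n = card S"
  have n: "n > 0" using fin ne by (auto simp: n_def)
  have a0: "a \<noteq> 0" using a by simp
  obtain P where P: "finite P"
    "\<And>V. V \<in> P \<Longrightarrow> V \<subseteq> S" "\<And>V. V \<in> P \<Longrightarrow> n \<le> 4 * q * card V"
    "\<And>V. V \<in> P \<Longrightarrow> card (dil_diff V 1 V) \<le> 1024 * real q ^ 5 * n"
    "pairwise disjnt P" "card P \<le> 4 * q"
    "card {(x, y, z) \<in> solutions a S. x \<notin> \<Union>P \<or> y \<notin> \<Union>P \<or> z \<notin> \<Union>P} \<le> 3 * (real n)\<^sup>2 / q"
    unfolding n_def using structured_decomposition[OF fin ne a0 q] by blast
  have finV: "finite V" if "V \<in> P" for V using P(2)[OF that] fin by (rule finite_subset)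
  define E where "E = (\<lambda>U V d. \<bar>d\<bar> \<le> 1 \<and>
    card (dil_diff U (- (real_of_int a powi - d)) V) \<le> 2 ^ 25 * real q ^ 13 * n)"
  have "\<exists>lev. \<forall>U\<in>P. \<forall>V\<in>P. \<forall>d. E U V d \<longrightarrow> lev V = lev U + d"
  proof (rule potential_exists[OF P(1)])
    fix U V d assume "E U V d"
    moreover have "- (real_of_int a powi - (- d)) = inverse (- (real_of_int a powi - d))"
      by (simp add: power_int_minus)
    then have "card (dil_diff V (- (real_of_int a powi - (- d))) U) = card (dil_diff U (- (real_of_int a powi - d)) V)"
      using a by (metis card_dil_diff_inverse neg_equal_0_iff_equal of_int_0_eq_iff power_int_not_zero a0)
    ultimately show "E V U (- d)" by (simp add: E_def)
  next
    fix U e k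
    assume "U \<in> P" "k < 2 * card P"
      "((U, 0), (U, e)) \<in> {((u, e), (v, f)). u \<in> P \<and> v \<in> P \<and> E u v (f - e)} ^^ k"
    then show "e = 0"
      unfolding E_def
      by (rule no_unbalanced_closed_walk[OF a q n growth finV P(3) P(4) P(6), rotated -3])
        (use dilates finV P(3) in \<open>auto simp: n_def\<close>)
  qed
  then obtain lev where lev: "\<And>U V d. U \<in> P \<Longrightarrow> V \<in> P \<Longrightarrow> E U V d \<Longrightarrow> lev V = lev U + d" by blast
  define pc where "pc x = (SOME V. V \<in> P \<and> x \<in> V)" for x
  have pc: "pc x \<in> P" "x \<in> pc x" if "x \<in> \<Union>P" for x
    using someI_ex[of "\<lambda>V. V \<in> P \<and> x \<in> V"] that unfolding pc_def by auto
  \<comment> \<open>With at most (4 q)^2 pairs of pieces, the sparse ones lose at most 16 q^2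
    \<theta> n^2 = n^2 / (2 q).\<close>
  define \<theta> where "\<theta> = 1 / (32 * real q ^ 3)"
  have \<theta>: "\<theta> > 0" using q by (simp add: \<theta>_def)
  define N where "N \<beta> W = (\<lambda>(U, V). {(x, y). x \<in> U \<and> y \<in> V \<and> x + \<beta> * y \<in> W})" for \<beta> :: int and W
  define B where "B \<beta> W = (\<Union>p\<in>{p \<in> P \<times> P. card (N \<beta> W p) < \<theta> * n\<^sup>2}. N \<beta> W p)" for \<beta> W
  define W1 where "W1 = (\<lambda>z. - (a * z)) ` S"
  define W2 where "W2 = uminus ` S"
  have W: "finite W1" "card W1 \<le> n" "finite W2" "card W2 \<le> n"
    using fin by (auto simp: W1_def W2_def n_def card_image_le)
  have B_fin: "finite (B \<beta> W)" for \<beta> W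
    by (rule finite_subset[of _ "S \<times> S"]) (use P(2) fin in \<open>auto simp: B_def N_def\<close>)
  have B_card: "card (B \<beta> W) \<le> (real n)\<^sup>2 / (2 * q)" for \<beta> W
  proof -
    have "card (B \<beta> W) \<le> (real (card P))\<^sup>2 * (\<theta> * n\<^sup>2)"
      unfolding B_def by (rule card_UN_sparse_le) (use P \<theta> in auto)
    also have "\<dots> \<le> (4 * real q)\<^sup>2 * (\<theta> * n\<^sup>2)"
      using of_nat_mono[OF P(6), where ?'a = real] \<theta> by (intro mult_right_mono power_mono) auto
    also have "\<dots> = (real n)\<^sup>2 / (2 * q)"
      using q by (simp add: \<theta>_def field_simps eval_nat_numeral)
    finally show ?thesis .
  qed
  have dense: "card (dil_diff U (- real_of_int \<beta>) V) \<le> 2 ^ 25 * real q ^ 13 * n"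
    if UV: "U \<in> P" "V \<in> P" and W: "finite W" "card W \<le> n" and \<beta>: "\<beta> \<noteq> 0"
      and xy: "x \<in> U" "y \<in> V" "x + \<beta> * y \<in> W" "(x, y) \<notin> B \<beta> W" for U V W x y and \<beta> :: int
  proof -
    have "\<not> card (N \<beta> W (U, V)) < \<theta> * n\<^sup>2"
      using xy UV unfolding B_def N_def by blast
    then have "\<theta> * card (dil_diff U (- real_of_int \<beta>) V) \<le> (1024 * real q ^ 5)\<^sup>2 * n"
      by (intro card_dil_diff_popular[OF _ _ W n \<beta> P(4)[OF UV(1)] P(4)[OF UV(2)] \<theta>])
        (use finV UV in \<open>auto simp: N_def\<close>)
    then show ?thesis using q by (simp add: \<theta>_def field_simps eval_nat_numeral)
  qed
  define G where "G = {(x, y, z) \<in> solutions a S. \<not> (lev (pc x) = lev (pc z) + 1 \<and> lev (pc y) = lev (pc z) + 1)}"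
  define X0 where "X0 = {(x, y, z) \<in> solutions a S. x \<notin> \<Union>P \<or> y \<notin> \<Union>P \<or> z \<notin> \<Union>P}"
  define X1 where "X1 = {(x, y, z) \<in> solutions a S. (x, y) \<in> B 1 W1}"
  define X2 where "X2 = {(x, y, z) \<in> solutions a S. (x, z) \<in> B a W2}"
  have finX: "finite X0" "finite X1" "finite X2"
    by (rule finite_subset[OF _ finite_solutions[OF fin, of a]]; auto simp: X0_def X1_def X2_def)+
  have "G \<subseteq> X0 \<union> X1 \<union> X2"
  proof
    fix p assume "p \<in> G"
    then obtain x y z where p: "p = (x, y, z)" "(x, y, z) \<in> solutions a S"
      "\<not> (lev (pc x) = lev (pc z) + 1 \<and> lev (pc y) = lev (pc z) + 1)" by (auto simp: G_def)
    show "p \<in> X0 \<union> X1 \<union> X2"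
    proof (rule ccontr)
      assume "p \<notin> X0 \<union> X1 \<union> X2"
      then have *: "x \<in> \<Union>P" "y \<in> \<Union>P" "z \<in> \<Union>P" "(x, y) \<notin> B 1 W1" "(x, z) \<notin> B a W2"
        using p by (auto simp: X0_def X1_def X2_def)
      have xW: "x + 1 * y \<in> W1" "x + a * z \<in> W2"
        using p(2) by (auto simp: solutions_def W1_def W2_def image_iff eq_neg_iff_add_eq_0 ac_simps)
      have "card (dil_diff (pc x) (- real_of_int 1) (pc y)) \<le> 2 ^ 25 * real q ^ 13 * n"
        by (rule dense[OF pc(1)[OF *(1)] pc(1)[OF *(2)] W(1,2) _ pc(2)[OF *(1)] pc(2)[OF *(2)] xW(1) *(4)]) simp
      moreover have "card (dil_diff (pc x) (- real_of_int a) (pc z)) \<le> 2 ^ 25 * real q ^ 13 * n"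
        by (rule dense[OF pc(1)[OF *(1)] pc(1)[OF *(3)] W(3,4) a0 pc(2)[OF *(1)] pc(2)[OF *(3)] xW(2) *(5)])
      ultimately have "E (pc x) (pc y) 0" "E (pc x) (pc z) (- 1)" by (auto simp: E_def)
      then have "lev (pc y) = lev (pc x) + 0" "lev (pc z) = lev (pc x) + - 1"
        using lev pc * by blast+
      then show False using p(3) by simp
    qed
  qed
  then have "card G \<le> card (X0 \<union> X1 \<union> X2)" using finX by (intro card_mono) auto
  also have "\<dots> \<le> card X0 + card X1 + card X2"
    using card_Un_le[of "X0 \<union> X1" X2] card_Un_le[of X0 X1] by linarith
  also have "card X1 \<le> card (B 1 W1)"
    by (rule card_inj_on_le[OF inj_on_subset[OF inj_on_solutions[OF a0, of S]] _ B_fin])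
      (auto simp: X1_def)
  also have "card X2 \<le> card (B a W2)"
    by (rule card_inj_on_le[where f = "\<lambda>(x, y, z). (x, z)"])
      (use B_fin in \<open>auto simp: inj_on_def X2_def solutions_def\<close>)
  finally have "card G \<le> card X0 + card (B 1 W1) + card (B a W2)" by simp
  from of_nat_mono[OF this, where ?'a = real]
  have "real (card G) \<le> real (card X0) + real (card (B 1 W1)) + real (card (B a W2))" by simp
  also have "\<dots> \<le> 3 * (real n)\<^sup>2 / q + (real n)\<^sup>2 / (2 * q) + (real n)\<^sup>2 / (2 * q)"
    by (intro add_mono B_card) (use P(7) in \<open>simp add: X0_def\<close>)
  also have "\<dots> = 4 * (real n)\<^sup>2 / q" using q by (simp add: field_simps)
  finally show ?thesis using that[of "lev \<circ> pc"] by (simp add: G_def n_def)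
qed

section \<open>The upper density of solutions\<close>

lemma T_count_eq: "T_count 1 1 a S = card (solutions a S)"
  by (simp add: T_count_def solutions_def)

text \<open>x and y determine z. This trivial bound settles those \<open>a\<close> for which the
  claimed error is at least 1.\<close>

lemma gamma_coeff_le_one:
  assumes "a \<noteq> 0"
  shows "gamma_coeff 1 1 a \<le> 1"
  unfolding gamma_coeff_def
proof (rule Limsup_bounded)
  have "ereal (real (T_count 1 1 a S) / (real (card S))\<^sup>2) \<le> 1" if "finite S" "0 < card S" for S
  proof -
    have "card (solutions a S) \<le> card (S \<times> S)"
      by (rule card_inj_on_le[OF inj_on_solutions[OF assms]])
        (use that in \<open>auto simp: solutions_def\<close>)
    from of_nat_mono[OF this, where ?'a = real]
    have "real (card (solutions a S)) \<le> (real (card S))\<^sup>2"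
      by (simp add: card_cartesian_product power2_eq_square)
    then show ?thesis using that by (simp add: T_count_eq divide_le_eq)
  qed
  then show "\<forall>\<^sub>F S in card_at_top. ereal (real (T_count 1 1 a S) / (real (card S))\<^sup>2) \<le> 1"
    unfolding eventually_card_at_top by (intro exI[of _ 1]) auto
qed

text \<open>Finitely many dilates \<open>c\<close> share one threshold \<open>N\<close>, and the
  limsup sees only sets large enough for all their pieces to exceed it. Of the error 5 / q, ungraded
  solutions take 4 / q and the rounding term n / 4 the rest.\<close>

lemma gamma_coeff_le:
  fixes a :: int and q :: nat
  assumes a: "a \<ge> 2" and q: "q > 0" and growth: "(2 ^ 27 * real q ^ 14) ^ (8 * q) \<le> a"
  shows "gamma_coeff 1 1 a \<le> ereal (1 / 5 + 5 / q)"
  unfolding gamma_coeff_def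
proof (rule Limsup_bounded)
  define C where "C = {c::int. \<exists>s\<in>{1..8 * q}. \<bar>c\<bar> = a ^ s}"
  have "C \<subseteq> (\<lambda>s. a ^ s) ` {1..8 * q} \<union> (\<lambda>s. - (a ^ s)) ` {1..8 * q}"
    by (force simp: C_def abs_if split: if_splits)
  then have finC: "finite C" by (rule finite_subset) auto
  have "\<exists>N. \<forall>A. finite A \<longrightarrow> N \<le> card A \<longrightarrow> \<bar>c\<bar> * card A \<le> card (dilate_sum A c A)" if c: "c \<in> C" for c
  proof (rule card_dilate_sum_lower_bound)
    obtain s where "1 \<le> s" "\<bar>c\<bar> = a ^ s" using c by (auto simp: C_def)
    moreover have "a ^ 1 \<le> a ^ s" using a calculation by (intro power_increasing) auto
    ultimately show "2 \<le> \<bar>c\<bar>" using a by simp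
  qed
  then obtain M where M: "\<And>c A. c \<in> C \<Longrightarrow> finite A \<Longrightarrow> M c \<le> card A \<Longrightarrow> \<bar>c\<bar> * card A \<le> card (dilate_sum A c A)"
    by metis
  define N where "N = (\<Sum>c\<in>C. M c)"
  have MN: "M c \<le> N" if "c \<in> C" for c
    unfolding N_def using finC that by (intro member_le_sum) auto
  \<comment> \<open>The term 4 q N forces \<open>N\<close> \<le> \<open>card V\<close> whenever
    \<open>card S\<close> \<le> 4 q \<open>card V\<close>; the term q gives n / 4 \<le> n^2 /
    q.\<close>
  have "ereal (real (T_count 1 1 a S) / (real (card S))\<^sup>2) \<le> ereal (1 / 5 + 5 / q)"
    if S: "finite S" "4 * q * N + q \<le> card S" for S
  proof -
    define n where "n = card S"
    have n: "n > 0" "S \<noteq> {}" "q \<le> n" using S q by (auto simp: n_def)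
    have dilates: "\<bar>c\<bar> * card V \<le> card (dilate_sum V c V)"
      if V: "finite V" "card S \<le> 4 * q * card V" "1 \<le> s" "s \<le> 8 * q" "\<bar>c\<bar> = a ^ s" for V c s
    proof (rule M)
      show "c \<in> C" using V by (auto simp: C_def)
      moreover have "4 * q * N \<le> 4 * q * card V" using V(2) S(2) by linarith
      then have "N \<le> card V" using q by simp
      ultimately show "M c \<le> card V" using MN order_trans by blast
    qed fact
    obtain lev :: "int \<Rightarrow> int" where
      bad: "card {(x, y, z) \<in> solutions a S. \<not> (lev x = lev z + 1 \<and> lev y = lev z + 1)} \<le> 4 * (real (card S))\<^sup>2 / q"
      by (rule almost_graded[OF S(1) n(2) a q growth dilates])
    define G where "G = {(x, y, z) \<in> solutions a S. lev x = lev z + 1 \<and> lev y = lev z + 1}"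
    define H where "H = {(x, y, z) \<in> solutions a S. \<not> (lev x = lev z + 1 \<and> lev y = lev z + 1)}"
    have good: "card G \<le> (real n)\<^sup>2 / 5 + n / 4"
      unfolding G_def n_def by (rule card_graded_solutions_le) (use S a in auto)
    have "solutions a S = G \<union> H" by (auto simp: G_def H_def)
    then have "card (solutions a S) \<le> card G + card H" by (metis card_Un_le)
    from of_nat_mono[OF this, where ?'a = real]
    have "card (solutions a S) \<le> (real n)\<^sup>2 / 5 + n / 4 + 4 * (real n)\<^sup>2 / q"
      using good bad by (simp add: H_def n_def)
    also have "real n / 4 \<le> (real n)\<^sup>2 / q"
    proof -
      have "real n * q \<le> real n * n" using n by (intro mult_left_mono) auto
      then have "real n \<le> (real n)\<^sup>2 / q" using q by (simp add: field_simps power2_eq_square)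
      moreover have "real n / 4 \<le> real n" by simp
      ultimately show ?thesis by (rule order_trans[rotated])
    qed
    finally have "card (solutions a S) \<le> (1 / 5 + 5 / q) * (real n)\<^sup>2"
      by (simp add: algebra_simps)
    then show ?thesis using n by (simp add: T_count_eq divide_le_eq n_def)
  qed
  then show "\<forall>\<^sub>F S in card_at_top. ereal (real (T_count 1 1 a S) / (real (card S))\<^sup>2) \<le> ereal (1 / 5 + 5 / q)"
    unfolding eventually_card_at_top by blast
qed

text \<open>The proportion 3 : 2 of the two intervals maximises p m - m^2 / 4 subject to p + m = 1.\<close>
lemma gamma_coeff_ge:
  fixes a :: int
  assumes a: "a \<noteq> 0"
  shows "ereal (1 / 5) \<le> gamma_coeff 1 1 a"
  unfolding gamma_coeff_def Limsup_def
proof (rule INF_greatest, clarify)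
  fix Q :: "int set \<Rightarrow> bool"
  assume "eventually Q card_at_top"
  then obtain k where Q: "\<And>S. finite S \<Longrightarrow> k \<le> card S \<Longrightarrow> Q S"
    unfolding eventually_card_at_top by auto
  define K where "K = int k"
  define A where "A = (\<lambda>x. a * x) ` {- (3 * K)..3 * K}"
  define B where "B = {- (2 * K)..2 * K}"
  define S where "S = A \<union> B"
  have fin: "finite S" by (simp add: S_def A_def B_def)
  have cA: "card A = 6 * k + 1"
    unfolding A_def using a by (subst card_image) (auto simp: inj_on_def K_def)
  have cB: "card B = 4 * k + 1" by (simp add: B_def K_def)
  have "card A \<le> card S" by (rule card_mono[OF fin]) (simp add: S_def)
  then have S_pos: "k \<le> card S" "0 < card S" using cA by auto
  have S_le: "card S \<le> 10 * k + 2" unfolding S_def using card_Un_le[of A B] cA cB by simp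
  \<comment> \<open>The solution (a x, a (-z - x), z) needs x and -z - x in [-3K, 3K], leaving 6 K +
    1 - |z| values of x.\<close>
  define F where "F z = {max (- (3 * K)) (- (3 * K) - z)..min (3 * K) (3 * K - z)}" for z :: int
  have "card (SIGMA z:B. F z) \<le> card (solutions a S)"
  proof (rule card_inj_on_le[where f = "\<lambda>(z, x). (a * x, a * (- z - x), z)"])
    show "inj_on (\<lambda>(z, x). (a * x, a * (- z - x), z)) (SIGMA z:B. F z)"
      using a by (auto simp: inj_on_def)
    have "a * x \<in> A" "a * (- z - x) \<in> A" if "x \<in> F z" for x z
      unfolding A_def by (intro imageI; use that in \<open>auto simp: F_def\<close>)+
    then show "(\<lambda>(z, x). (a * x, a * (- z - x), z)) ` (SIGMA z:B. F z) \<subseteq> solutions a S"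
      by (auto simp: solutions_def S_def algebra_simps)
  qed (use fin in simp)
  also have "card (SIGMA z:B. F z) = (\<Sum>z\<in>B. card (F z))"
    by (simp add: B_def F_def)
  finally have "int (\<Sum>z\<in>B. card (F z)) \<le> int (card (solutions a S))"
    by (rule of_nat_mono)
  moreover have "int (\<Sum>z\<in>B. card (F z)) = 20 * K\<^sup>2 + 8 * K + 1"
  proof -
    have sum_abs: "(\<Sum>z\<in>{- int m..int m}. 6 * K + 1 - \<bar>z\<bar>) = (2 * m + 1) * (6 * K + 1) - int m * (m + 1)" for m
    proof (induction m)
      case (Suc m)
      have "{- int (Suc m)..int (Suc m)} = insert (- int (Suc m)) (insert (int (Suc m)) {- int m..int m})"
        by auto
      then show ?case using Suc by (simp add: algebra_simps)
    qed simp
    have "int (\<Sum>z\<in>B. card (F z)) = (\<Sum>z\<in>B. 6 * K + 1 - \<bar>z\<bar>)"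
      unfolding of_nat_sum by (rule sum.cong) (auto simp: B_def F_def K_def)
    also have "\<dots> = (2 * int (2 * k) + 1) * (6 * K + 1) - int (2 * k) * (int (2 * k) + 1)"
      using sum_abs[of "2 * k"] by (simp add: B_def K_def)
    also have "\<dots> = 20 * K\<^sup>2 + 8 * K + 1"
      by (simp add: K_def power2_eq_square algebra_simps)
    finally show ?thesis .
  qed
  ultimately have "20 * K\<^sup>2 + 8 * K + 1 \<le> card (solutions a S)" by simp
  then have "real_of_int (20 * K\<^sup>2 + 8 * K + 1) \<le> real_of_int (card (solutions a S))"
    by (rule of_int_le_iff[THEN iffD2])
  then have T: "20 * (real k)\<^sup>2 + 8 * k + 1 \<le> card (solutions a S)" by (simp add: K_def)
  have "(real (card S))\<^sup>2 \<le> (10 * real k + 2)\<^sup>2"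
    using of_nat_mono[OF S_le, where ?'a = real] by (intro power_mono) auto
  \<comment> \<open>The sides are 100 k^2 + 40 k + 4 and 100 k^2 + 40 k + 5, so the ratio is at
    least 1/5 for every k, without a limit.\<close>
  also have "\<dots> \<le> 5 * (20 * (real k)\<^sup>2 + 8 * k + 1)"
    by (simp add: power2_eq_square algebra_simps)
  finally have "1 / 5 \<le> real (card (solutions a S)) / (real (card S))\<^sup>2"
    using T S_pos by (simp add: field_simps)
  then have "ereal (1 / 5) \<le> ereal (real (T_count 1 1 a S) / (real (card S))\<^sup>2)"
    by (simp add: T_count_eq)
  also have "\<dots> \<le> (SUP S\<in>Collect Q. ereal (real (T_count 1 1 a S) / (real (card S))\<^sup>2))"
    by (rule SUP_upper) (use Q[OF fin S_pos(1)] in simp)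
  finally show "ereal (1 / 5) \<le> (SUP S\<in>Collect Q. ereal (real (T_count 1 1 a S) / (real (card S))\<^sup>2))" .
qed

text \<open>Since q \<le> ln a, the logarithm of the base is at most (27 + 14) ln (ln a).
  Multiplying by 8 q gives 328 q ln (ln a), and 400 is a round number above 328.\<close>

lemma growth_condition:
  fixes a :: real and q :: nat
  assumes q: "q > 0" and a: "a > 1" and ll: "1 \<le> ln (ln a)" and qle: "q * (400 * ln (ln a)) \<le> ln a"
  shows "(2 ^ 27 * real q ^ 14) ^ (8 * q) \<le> a"
proof -
  have ln_a: "ln a > 0" using a by simp
  have "real q * 1 \<le> q * (400 * ln (ln a))" using ll by (intro mult_left_mono) auto
  then have "real q \<le> ln a" using qle by simp
  then have lnq: "ln (real q) \<le> ln (ln a)" using q ln_a by simp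
  have "ln (2 ^ 27 * real q ^ 14) = 27 * ln 2 + 14 * ln (real q)"
    using q by (simp add: ln_mult ln_realpow del: power_numeral)
  also have "\<dots> \<le> 27 * 1 + 14 * ln (ln a)"
    using ln_le_minus_one[of 2] by (intro add_mono mult_left_mono lnq) auto
  also have "\<dots> \<le> 41 * ln (ln a)" using ll by linarith
  finally have L: "ln (2 ^ 27 * real q ^ 14) \<le> 41 * ln (ln a)" .
  have pos: "0 < 2 ^ 27 * real q ^ 14" using q by simp
  have "ln ((2 ^ 27 * real q ^ 14) ^ (8 * q)) = real (8 * q) * ln (2 ^ 27 * real q ^ 14)"
    by (rule ln_realpow)
  also have "\<dots> \<le> real (8 * q) * (41 * ln (ln a))" by (intro mult_left_mono L) auto
  also have "\<dots> = 328 * (q * ln (ln a))" by simp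
  also have "\<dots> \<le> 400 * (q * ln (ln a))" using ll by (intro mult_right_mono) auto
  also have "\<dots> \<le> ln a" using qle by simp
  finally show ?thesis using a zero_less_power[OF pos] by (subst (asm) ln_le_cancel_iff) auto
qed

lemma ereal_dist_le:
  fixes g :: ereal
  assumes "ereal c \<le> g" "g \<le> ereal (c + d)"
  shows "\<bar>g - ereal c\<bar> \<le> ereal d"
  using assms by (cases g) auto

theorem theorem1p6:
  "\<exists>C::real. \<forall>a::int. a \<ge> 3 \<longrightarrow>
     \<bar>gamma_coeff 1 1 a - ereal (1 / 5)\<bar>
       \<le> ereal (C * (ln (ln (real_of_int a)) / ln (real_of_int a)))"
proof -
  \<comment> \<open>The least value of ln (ln a) for a \<ge> 3, positive because e < 3; it controls
    the small \<open>a\<close>.\<close>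
  define c0 :: real where "c0 = ln (ln 3)"
  have exp1: "exp 1 < (3 :: real)"
  proof -
    have "exp 1 = exp (1 / 4 :: real) ^ 4" by (simp flip: exp_of_nat_mult)
    also have "\<dots> \<le> (1 + 1 / 4 + (1 / 4)\<^sup>2) ^ 4"
      using exp_bound[of "1 / 4"] by (intro power_mono) auto
    also have "\<dots> < 3" by (simp add: power_divide eval_nat_numeral)
    finally show ?thesis .
  qed
  then have ln3: "1 < ln (3 :: real)" by (metis exp_gt_zero ln_exp ln_less_cancel_iff zero_less_numeral)
  then have c0: "c0 > 0" by (simp add: c0_def)
  have "\<bar>gamma_coeff 1 1 a - ereal (1 / 5)\<bar>
      \<le> ereal ((4000 + 3 / c0) * (ln (ln (real_of_int a)) / ln (real_of_int a)))" if a3: "a \<ge> 3" for a :: int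
  proof -
    define x where "x = ln (real_of_int a)"
    have "ln 3 \<le> x" unfolding x_def using a3 by simp
    then have x: "1 < x" "c0 \<le> ln x" using ln3 by (auto simp: c0_def)
    then have lnx: "0 < ln x" by simp
    have ge: "ereal (1 / 5) \<le> gamma_coeff 1 1 a" by (rule gamma_coeff_ge) (use a3 in simp)
    have C: "4000 * (ln x / x) \<le> (4000 + 3 / c0) * (ln x / x)"
      using c0 x lnx by (intro mult_right_mono) auto
    show ?thesis
    proof (cases "1 \<le> ln x \<and> 400 * ln x \<le> x")
      case True
      \<comment> \<open>\<open>growth_condition\<close> admits every q up to y. Rounding y \<ge> 1
        down at most halves it, so 5 / q \<le> 10 / y = 4000 ln x / x.\<close>
      define y where "y = x / (400 * ln x)"
      have y: "1 \<le> y" using True lnx by (simp add: y_def field_simps)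
      define q where "q = nat \<lfloor>y\<rfloor>"
      have fl: "1 \<le> \<lfloor>y\<rfloor>" using y by simp
      then have q: "0 < q" "real q \<le> y" "y < real q + 1"
        unfolding q_def by (simp_all add: of_nat_nat)
      have "(2 ^ 27 * real q ^ 14) ^ (8 * q) \<le> real_of_int a"
      proof (rule growth_condition[OF q(1)])
        have "real q * (400 * ln x) \<le> y * (400 * ln x)"
          using q(2) lnx by (intro mult_right_mono) auto
        then show "q * (400 * ln (ln (real_of_int a))) \<le> ln (real_of_int a)"
          using lnx by (simp add: y_def x_def)
      qed (use a3 True in \<open>auto simp: x_def\<close>)
      then have le: "gamma_coeff 1 1 a \<le> ereal (1 / 5 + 5 / q)"
        by (intro gamma_coeff_le) (use a3 q in auto)
      have "1 \<le> real q" using q(1) by simp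
      then have "y \<le> 2 * real q" using q(3) by linarith
      then have "10 / (2 * real q) \<le> 10 / y" using q(1) y by (intro divide_left_mono) auto
      then have "5 / q \<le> 10 / y" by simp
      also have "\<dots> = 4000 * (ln x / x)" by (simp add: y_def)
      also note C
      finally have "1 / 5 + 5 / q \<le> 1 / 5 + (4000 + 3 / c0) * (ln x / x)" by simp
      then show ?thesis unfolding x_def[symmetric]
        by (intro ereal_dist_le ge order_trans[OF le]) simp
    next
      case False
      \<comment> \<open>Either x < 400 ln x and the term 4000 suffices, or ln x < 1, so that x < e <
        3 while ln x \<ge> c0, and the term 3 / c0 suffices.\<close>
      have "1 \<le> (4000 + 3 / c0) * (ln x / x)"
      proof (cases "1 \<le> ln x")
        case True
        with False have "x < 400 * ln x" by simp
        then have "1 \<le> 4000 * (ln x / x)" using x by (simp add: field_simps)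
        then show ?thesis using C by linarith
      next
        case False
        then have "x < exp 1" using x by (metis exp_less_mono exp_ln not_le less_trans zero_less_one)
        then have "x \<le> 3" using exp1 by simp
        then have "c0 * x \<le> ln x * 3" using x c0 lnx by (intro mult_mono) auto
        then have "1 \<le> 3 / c0 * (ln x / x)" using x c0 by (simp add: field_simps)
        also have "\<dots> \<le> (4000 + 3 / c0) * (ln x / x)" using x lnx by (intro mult_right_mono) auto
        finally show ?thesis .
      qed
      then have "(1 :: ereal) \<le> ereal (1 / 5 + (4000 + 3 / c0) * (ln x / x))" by simp
      moreover have "gamma_coeff 1 1 a \<le> 1" by (rule gamma_coeff_le_one) (use a3 in simp)
      ultimately show ?thesis unfolding x_def[symmetric]
        by (intro ereal_dist_le ge) (rule order_trans)
    qed
  qed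
  then show ?thesis by blast
qed

end
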